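(* Let $(X_n)_{n\in\mathbb N}$ be the non-autonomous Markov chain generated by $$V_{n+1}=\beta_n\nabla\Psi(X_n)+\Delta B_{n+1},\qquad X_{n+1}=(\mathrm{Id}+\lambda_n\mathsf A)^{-1}(X_n-\lambda_nV_{n+1}),\qquad X_0=\xi,$$ in the setting described in the context. Assume that $\limsup_{n\to\infty}\lambda_n\beta_n<\frac{2}{L_\Psi}$; that for every $p\in\mathrm{Range}(\mathrm N_C)$, $$\sum_{n\ge1}\lambda_n\beta_n\,h_C(p/\beta_n)<\infty ;$$ and that there are numbers $s_n\ge 0$ with $\sup_{x\in\mathbb R^d}\|\sigma_n(x)\|_{\mathrm F}^2\le s_n^2$ for all $n$, $\sum_{n\ge1}\lambda_n^2<\infty$ and $\sum_{n\ge1}\lambda_ns_n^2<\infty$. Then: (1) for every $z\in\mathcal S=\mathrm{zer}(\mathsf A+\mathrm N_C)$, $\lim_{n\to\infty}\mathbb E[\|X_n-z\|^2]$ exists in $\mathbb R$; (2) $\mathbb E[\|X_{n+1}-X_n\|^2]$, $\mathbb E[\lambda_n\beta_n\Psi(X_n)]$ and $\mathbb E[\lambda_n\beta_n\|\nabla\Psi(X_n)\|^2]$ all converge to $0$ as $n\to\infty$; (3) if $\inf_{n\ge1}\lambda_n\beta_n>0$, then $\Psi(X_n)\to0$ and $\|\nabla\Psi(X_n)\|\to0$ almost surely.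
   Context: $\mathsf A:\mathbb R^d\to2^{\mathbb R^d}$ is maximally monotone, $C\subset\mathbb R^d$ is nonempty, closed and convex, $\mathrm N_C$ is the normal cone mapping of $C$, $\mathrm{int}(\mathrm{dom}\,\mathsf A)\ne\emptyset$, $\mathsf A+\mathrm N_C$ is maximally monotone, and $\mathcal S=\{x:0\in\mathsf A(x)+\mathrm N_C(x)\}\ne\emptyset$. $\Psi:\mathbb R^d\to\mathbb R$ is convex and continuously differentiable, $\nabla\Psi$ is $L_\Psi$-Lipschitz ($L_\Psi>0$), and $C=\Psi^{-1}(0)=\mathrm{argmin}\,\Psi$. $h_C(x^* )=\Psi^*(x^* )-\mathsf s_C(x^* )$, where $\Psi^*$ is the Fenchel conjugate of $\Psi$ and $\mathsf s_C(x^* )=\sup_{u\in C}\langle x^*,u\rangle$. Discretization: $0=t_0<t_1<\dots$ are time points, $\lambda_n=t_{n+1}-t_n>0$, and $\beta_n=\beta(t_n)$ for a non-decreasing, (locally) absolutely continuous $\beta:[0,\infty)\to(0,\infty)$. On a filtered probability space $(\Omega,\mathcal F,(\mathcal F_t)_{t\ge0},\mathbb P)$, $W$ is an $m$-dimensional Brownian motion, $\sigma:[0,\infty)\times\mathbb R^d\to\mathbb R^{d\times m}$ is measurable, $\sigma_n(x)=\sigma(t_n,x)$, $\Delta W_{n+1}=W_{t_{n+1}}-W_{t_n}$ and $\Delta B_{n+1}=\sigma_n(X_n)\Delta W_{n+1}$. The initial value $\xi\in L^2(\Omega;\mathrm{cl}(\mathrm{dom}\,\mathsf A))$ is $\mathcal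 F_0$-measurable. $\|\cdot\|_{\mathrm F}$ is the Frobenius norm. *)

theory Defs
  imports "HOL-Probability.Probability"
begin

type_synonym 'a setmap = "'a \<Rightarrow> 'a set"

definition op_dom :: "'a setmap \<Rightarrow> 'a set" where
  "op_dom A = {x. A x \<noteq> {}}"

definition op_range :: "'a setmap \<Rightarrow> 'a set" where
  "op_range A = (\<Union>x. A x)"

definition op_graph :: "'a setmap \<Rightarrow> ('a \<times> 'a) set" where
  "op_graph A = {(x, u). u \<in> A x}"

definition op_zer :: "'a::zero setmap \<Rightarrow> 'a set" where
  "op_zer A = {x. 0 \<in> A x}"

definition op_inverse :: "'a setmap \<Rightarrow> 'a setmap" where
  "op_inverse A u = {x. u \<in> A x}"

definition op_add :: "'a::plus setmap \<Rightarrow> 'a setmap \<Rightarrow> 'a setmap" where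
  "op_add A B x = {u + v | u v. u \<in> A x \<and> v \<in> B x}"

definition op_scale :: "real \<Rightarrow> 'a::real_vector setmap \<Rightarrow> 'a setmap" where
  "op_scale c A x = (\<lambda>u. c *\<^sub>R u) ` A x"

definition op_id :: "'a setmap" where
  "op_id x = {x}"

definition monotone_op :: "'a::real_inner setmap \<Rightarrow> bool" where
  "monotone_op A \<longleftrightarrow>
     (\<forall>x y. \<forall>u\<in>A x. \<forall>v\<in>A y. 0 \<le> inner (x - y) (u - v))"

definition maximally_monotone :: "'a::real_inner setmap \<Rightarrow> bool" where
  "maximally_monotone A \<longleftrightarrow> monotone_op A \<and>
     (\<forall>B. monotone_op B \<and> op_graph A \<subseteq> op_graph B \<longrightarrow> op_graph B = op_graph A)"

text \<open>The resolvent as the set-valued inverse of \<open>Id + c A\<close>. For maximally monotone \<open>A\<close>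
  and \<open>c > 0\<close> all its values are singletons.\<close>

definition resolvent :: "real \<Rightarrow> 'a::real_vector setmap \<Rightarrow> 'a setmap" where
  "resolvent c A = op_inverse (op_add op_id (op_scale c A))"

definition normal_cone :: "'a::real_inner set \<Rightarrow> 'a setmap" where
  "normal_cone C x = (if x \<in> C then {p. \<forall>u\<in>C. inner p (u - x) \<le> 0} else {})"

definition fenchel_conjugate :: "('a::real_inner \<Rightarrow> real) \<Rightarrow> 'a \<Rightarrow> ereal" where
  "fenchel_conjugate \<Psi> p = (SUP x. ereal (inner p x - \<Psi> x))"

definition support_fun :: "'a::real_inner set \<Rightarrow> 'a \<Rightarrow> ereal" where
  "support_fun C p = (SUP u\<in>C. ereal (inner p u))"

text \<open>The subtraction is in \<^typ>\<open>ereal\<close>, where \<open>\<infinity> - \<infinity> = \<infinity>\<close>. This case does not arise for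
  \<open>p\<close> in the range of the normal cone, where the support function is finite.\<close>

definition h_fun :: "('a::real_inner \<Rightarrow> real) \<Rightarrow> 'a set \<Rightarrow> 'a \<Rightarrow> ereal" where
  "h_fun \<Psi> C p = fenchel_conjugate \<Psi> p - support_fun C p"

definition abs_continuous_on_Icc :: "real \<Rightarrow> real \<Rightarrow> (real \<Rightarrow> real) \<Rightarrow> bool" where
  "abs_continuous_on_Icc a b f \<longleftrightarrow>
     (\<forall>\<epsilon>>0. \<exists>\<delta>>0. \<forall>(n::nat) l u.
        (\<forall>i<n. a \<le> l i \<and> l i \<le> u i \<and> u i \<le> b) \<and>
        (\<forall>i<n. \<forall>j<n. i \<noteq> j \<longrightarrow> {l i<..<u i} \<inter> {l j<..<u j} = {}) \<and>
        (\<Sum>i<n. u i - l i) < \<delta> \<longrightarrow>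
        (\<Sum>i<n. \<bar>f (u i) - f (l i)\<bar>) < \<epsilon>)"

definition locally_abs_continuous_nonneg :: "(real \<Rightarrow> real) \<Rightarrow> bool" where
  "locally_abs_continuous_nonneg f \<longleftrightarrow> (\<forall>T>0. abs_continuous_on_Icc 0 T f)"

definition frobenius_norm :: "real ^ 'm ^ 'd \<Rightarrow> real" where
  "frobenius_norm S = sqrt (\<Sum>i\<in>UNIV. \<Sum>j\<in>UNIV. (S $ i $ j)\<^sup>2)"

text \<open>Time is \<open>[0, \<infinity>)\<close>; the values of a filtration or process at negative reals are
  irrelevant.\<close>

definition filtration_nonneg :: "'w measure \<Rightarrow> (real \<Rightarrow> 'w measure) \<Rightarrow> bool" where
  "filtration_nonneg M F \<longleftrightarrow>
     (\<forall>t\<ge>0. subalgebra M (F t)) \<and> (\<forall>s t. 0 \<le> s \<and> s \<le> t \<longrightarrow> subalgebra (F t) (F s))"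

definition brownian_motion ::
  "'w measure \<Rightarrow> (real \<Rightarrow> 'w measure) \<Rightarrow> (real \<Rightarrow> 'w \<Rightarrow> real ^ 'm) \<Rightarrow> bool" where
  "brownian_motion M F W \<longleftrightarrow>
     (\<forall>t\<ge>0. W t \<in> borel_measurable (F t)) \<and>
     (AE \<omega> in M. W 0 \<omega> = 0) \<and>
     (AE \<omega> in M. continuous_on {0..} (\<lambda>t. W t \<omega>)) \<and>
     (\<forall>s t. 0 \<le> s \<and> s < t \<longrightarrow>
        distributed M lborel (\<lambda>\<omega>. W t \<omega> - W s \<omega>)
          (\<lambda>x. ennreal (\<Prod>i\<in>UNIV. normal_density 0 (sqrt (t - s)) (x $ i))) \<and>
        prob_space.indep_set M (sets (F s))
          {(\<lambda>\<omega>. W t \<omega> - W s \<omega>) -` B \<inter> space M | B. B \<in> sets borel})"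

end

theory Submission
  imports Defs
begin

text \<open>Fix \<open>z\<close> in \<open>\<S>\<close> and choose \<open>p \<in> N\<^sub>C z\<close> with \<open>- p \<in> A z\<close>. The iterate satisfies
  \<open>(X\<^sub>n - \<lambda>\<^sub>n V\<^sub>n\<^sub>+\<^sub>1 - X\<^sub>n\<^sub>+\<^sub>1) / \<lambda>\<^sub>n \<in> A X\<^sub>n\<^sub>+\<^sub>1\<close>, so monotonicity of \<open>A\<close>, tested against \<open>- p \<in> A z\<close>, bounds
  \<open>\<parallel>X\<^sub>n\<^sub>+\<^sub>1 - z\<parallel>\<^sup>2 + \<parallel>X\<^sub>n\<^sub>+\<^sub>1 - X\<^sub>n\<parallel>\<^sup>2\<close> by \<open>\<parallel>X\<^sub>n - z\<parallel>\<^sup>2\<close> plus cross terms of three kinds.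

  The penalty terms. Since \<open>\<nabla>\<Psi>\<close> vanishes on \<open>C\<close>, convexity and smoothness give
  \<open>\<langle>\<nabla>\<Psi>(x), x - z\<rangle> \<ge> \<Psi>(x) + \<parallel>\<nabla>\<Psi>(x)\<parallel>\<^sup>2 / (2 L)\<close> and \<open>\<Psi>(x) \<ge> \<parallel>\<nabla>\<Psi>(x)\<parallel>\<^sup>2 / (2 L)\<close>. A share \<open>\<theta>\<close> of
  \<open>2 \<lambda>\<^sub>n \<beta>\<^sub>n \<langle>\<nabla>\<Psi>(X\<^sub>n), X\<^sub>n - z\<rangle>\<close> is used to produce \<open>2 \<theta> \<lambda>\<^sub>n \<beta>\<^sub>n \<Psi>(X\<^sub>n)\<close>; the share \<open>1 - \<theta>\<close>, bounded below
  by \<open>\<parallel>\<nabla>\<Psi>(X\<^sub>n)\<parallel>\<^sup>2 / L\<close>, absorbs the gradient square that Young's inequality creates from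
  \<open>\<langle>X\<^sub>n\<^sub>+\<^sub>1 - X\<^sub>n, \<nabla>\<Psi>(X\<^sub>n)\<rangle>\<close>. Something is left over for small \<open>\<theta>\<close> exactly because \<open>limsup \<lambda>\<^sub>n \<beta>\<^sub>n < 2 / L\<close>.

  The term \<open>2 \<lambda>\<^sub>n \<langle>X\<^sub>n - z, p\<rangle>\<close>. By the Fenchel-Young inequality at the dual point \<open>(2 / \<theta>) p / \<beta>\<^sub>n\<close>, which
  is again in \<open>N\<^sub>C z\<close>, it is at most \<open>\<theta> \<lambda>\<^sub>n \<beta>\<^sub>n (\<Psi>(X\<^sub>n) + h\<^sub>C((2 / \<theta>) p / \<beta>\<^sub>n))\<close>. The first summand uses up
  half of the gain in \<open>\<Psi>\<close>, the second is summable. Replacing \<open>X\<^sub>n\<close> by \<open>X\<^sub>n\<^sub>+\<^sub>1\<close> costs, by Young's inequality, a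
  little of \<open>\<parallel>X\<^sub>n\<^sub>+\<^sub>1 - X\<^sub>n\<parallel>\<^sup>2\<close> and a multiple of \<open>\<lambda>\<^sub>n\<^sup>2 \<parallel>p\<parallel>\<^sup>2\<close>, which is summable as well.

  The noise. The part \<open>\<langle>X\<^sub>n - z, \<Delta>B\<^sub>n\<^sub>+\<^sub>1\<rangle>\<close> has mean zero because the Brownian increment is centred and
  independent of the past; the remaining part costs a multiple of \<open>\<lambda>\<^sub>n\<^sup>2 E \<parallel>\<Delta>B\<^sub>n\<^sub>+\<^sub>1\<parallel>\<^sup>2\<close>, of order \<open>\<lambda>\<^sub>n\<^sup>3 s\<^sub>n\<^sup>2\<close>.

  In expectation this is a recursion \<open>a\<^sub>n\<^sub>+\<^sub>1 + b\<^sub>n \<le> a\<^sub>n + e\<^sub>n\<close> for large \<open>n\<close>, with nonnegative terms and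
  summable \<open>e\<^sub>n\<close>, where \<open>a\<^sub>n = E \<parallel>X\<^sub>n - z\<parallel>\<^sup>2\<close> and \<open>b\<^sub>n\<close> combines the three expectations of part (2) with
  positive weights. Hence \<open>a\<^sub>n\<close> converges and \<open>b\<^sub>n\<close> is summable, which gives parts (1) and (2). If
  \<open>\<lambda>\<^sub>n \<beta>\<^sub>n\<close> is bounded away from zero, then \<open>\<Sum> E \<Psi>(X\<^sub>n)\<close> is finite, so \<open>\<Sum> \<Psi>(X\<^sub>n)\<close> is finite almost surely;
  this and the bound of \<open>\<parallel>\<nabla>\<Psi>\<parallel>\<^sup>2\<close> by \<open>\<Psi>\<close> give part (3). The pathwise inequality is \<open>forward_backward_step\<close>,
  the recursion is \<open>quasi_fejer_convergence\<close>, and \<open>diffusion_increment\<close> treats the noise.\<close>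

section \<open>Convex functions with Lipschitz gradient\<close>

lemma convex_gradient_inequality:
  fixes f :: "'a::real_inner \<Rightarrow> real"
  assumes conv: "convex_on UNIV f" and grad: "GDERIV f x :> g"
  shows "f x + inner g (y - x) \<le> f y"
proof -
  define \<phi> where "\<phi> r = f (x + r *\<^sub>R (y - x))" for r :: real
  have line: "convex_on UNIV \<phi>"
  proof (rule convex_onI)
    fix r a b :: real
    assume r: "0 < r" "r < 1"
    have "x + ((1 - r) *\<^sub>R a + r *\<^sub>R b) *\<^sub>R (y - x)
        = (1 - r) *\<^sub>R (x + a *\<^sub>R (y - x)) + r *\<^sub>R (x + b *\<^sub>R (y - x))"
      by (simp add: algebra_simps)
    then show "\<phi> ((1 - r) *\<^sub>R a + r *\<^sub>R b) \<le> (1 - r) * \<phi> a + r * \<phi> b"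
      using convex_onD[OF conv, of r "x + a *\<^sub>R (y - x)" "x + b *\<^sub>R (y - x)"] r
      by (simp add: \<phi>_def)
  qed simp
  have "(f has_derivative (\<lambda>h. inner h g)) (at (x + 0 *\<^sub>R (y - x)))"
    using grad by (simp add: gderiv_def)
  then have "((\<lambda>r. f (x + r *\<^sub>R (y - x))) has_derivative (\<lambda>h. inner (h *\<^sub>R (y - x)) g)) (at 0)"
    by (rule has_derivative_compose[rotated]) (auto intro!: derivative_eq_intros)
  then have "(\<phi> has_field_derivative inner g (y - x)) (at 0)"
    unfolding \<phi>_def has_field_derivative_def
    by (rule has_derivative_eq_rhs) (simp add: fun_eq_iff inner_commute)
  then have "inner g (y - x) * (1 - 0) \<le> \<phi> 1 - \<phi> 0"
    by (intro convex_on_imp_above_tangent[OF line]) auto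
  then show ?thesis by (simp add: \<phi>_def)
qed

text \<open>Along the segment from \<open>x\<close> to \<open>y\<close>, subtracting the linear part and the quadratic
  \<open>L / 2 * r\<^sup>2 * \<parallel>y - x\<parallel>\<^sup>2\<close> leaves a function of \<open>r\<close> whose derivative is nonpositive by the Lipschitz bound.\<close>

lemma descent_lemma:
  fixes f :: "'a::real_inner \<Rightarrow> real"
  assumes grad: "\<And>x. GDERIV f x :> g x" and lip: "L-lipschitz_on UNIV g"
  shows "f y \<le> f x + inner (g x) (y - x) + L / 2 * (norm (y - x))\<^sup>2"
proof -
  define d where "d = y - x"
  define \<phi> where "\<phi> r = f (x + r *\<^sub>R d) - r * inner (g x) d - L / 2 * r\<^sup>2 * (norm d)\<^sup>2" for r :: real
  have der: "(\<phi> has_real_derivative (inner (g (x + r *\<^sub>R d) - g x) d - L * r * (norm d)\<^sup>2)) (at r)" for r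
  proof -
    have "(f has_derivative (\<lambda>h. inner h (g (x + r *\<^sub>R d)))) (at (x + r *\<^sub>R d))"
      using grad by (simp add: gderiv_def)
    then have "((\<lambda>r. f (x + r *\<^sub>R d)) has_derivative (\<lambda>h. inner (h *\<^sub>R d) (g (x + r *\<^sub>R d)))) (at r)"
      by (rule has_derivative_compose[rotated]) (auto intro!: derivative_eq_intros)
    then have "((\<lambda>r. f (x + r *\<^sub>R d)) has_real_derivative inner (g (x + r *\<^sub>R d)) d) (at r)"
      unfolding has_field_derivative_def
      by (rule has_derivative_eq_rhs) (simp add: fun_eq_iff inner_commute)
    then show ?thesis
      unfolding \<phi>_def by (auto intro!: derivative_eq_intros simp: inner_diff_left)
  qed
  have "\<phi> 1 \<le> \<phi> 0"
  proof (rule DERIV_nonpos_imp_nonincreasing[of 0 1])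
    fix r :: real
    assume r: "0 \<le> r" "r \<le> 1"
    have "inner (g (x + r *\<^sub>R d) - g x) d \<le> norm (g (x + r *\<^sub>R d) - g x) * norm d"
      by (rule norm_cauchy_schwarz)
    also have "\<dots> \<le> L * (r * norm d) * norm d"
      using lipschitz_onD[OF lip, of "x + r *\<^sub>R d" x] r
      by (intro mult_right_mono) (auto simp: dist_norm)
    finally have "inner (g (x + r *\<^sub>R d) - g x) d - L * r * (norm d)\<^sup>2 \<le> 0"
      by (simp add: power2_eq_square mult.assoc)
    with der[of r] show "\<exists>y. (\<phi> has_real_derivative y) (at r) \<and> y \<le> 0"
      by blast
  qed simp
  then show ?thesis by (simp add: \<phi>_def d_def)
qed

text \<open>This sharpening of the gradient inequality carries the constant behind the step size bound \<open>2 / L\<close>.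
  Move from \<open>z\<close> by one gradient step of length \<open>1 / L\<close> for the convex function
  \<open>f - \<langle>g x, \<cdot>\<rangle>\<close>, which is minimal at \<open>x\<close>: the descent lemma says how much is gained on the way.\<close>

lemma convex_smooth_gradient_gap:
  fixes f :: "'a::real_inner \<Rightarrow> real"
  assumes conv: "convex_on UNIV f" and grad: "\<And>x. GDERIV f x :> g x"
    and L: "L > 0" and lip: "L-lipschitz_on UNIV g"
  shows "f x + inner (g x) (z - x) + (norm (g z - g x))\<^sup>2 / (2 * L) \<le> f z"
proof -
  define w where "w = z - (1 / L) *\<^sub>R (g z - g x)"
  have "f x + inner (g x) (w - x) \<le> f w"
    by (rule convex_gradient_inequality[OF conv grad])
  also have "f w \<le> f z + inner (g z) (w - z) + L / 2 * (norm (w - z))\<^sup>2"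
    by (rule descent_lemma[OF grad lip])
  finally have *: "f x + inner (g x) (w - x) \<le> f z + inner (g z) (w - z) + L / 2 * (norm (w - z))\<^sup>2" .
  define q where "q = g z - g x"
  have wz: "w - z = - ((1 / L) *\<^sub>R q)" and wx: "w - x = (z - x) - (1 / L) *\<^sub>R q"
    by (simp_all add: w_def q_def)
  have "L / 2 * (norm (w - z))\<^sup>2 = (norm q)\<^sup>2 / (2 * L)"
    using L by (simp add: wz power_divide power2_eq_square)
  moreover have "inner (g z) (w - z) - inner (g x) (w - x) = - inner (g x) (z - x) - (norm q)\<^sup>2 / L"
  proof -
    have "inner (g z) (w - z) - inner (g x) (w - x) = - inner (g x) (z - x) - (1 / L) * inner q q"
    proof -
      have "inner q q = inner (g z) q - inner (g x) q"
        by (subst (1) q_def) (rule inner_diff_left)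
      then show ?thesis
        unfolding wz wx by (simp only: inner_diff_right inner_minus_right inner_scaleR_right right_diff_distrib)
    qed
    then show ?thesis by (simp add: power2_norm_eq_inner)
  qed
  moreover have "(norm q)\<^sup>2 / L = 2 * ((norm q)\<^sup>2 / (2 * L))"
    by simp
  ultimately show ?thesis
    using * unfolding q_def by linarith
qed

section \<open>Resolvents of monotone operators\<close>

lemma resolvent_memberD:
  assumes "c > 0" "x \<in> resolvent c A y"
  shows "(1 / c) *\<^sub>R (y - x) \<in> A x"
  using assms by (auto simp: resolvent_def op_inverse_def op_add_def op_id_def op_scale_def)

lemma resolvent_memberI:
  assumes "u \<in> A x"
  shows "x \<in> resolvent c A (x + c *\<^sub>R u)"
  using assms by (auto simp: resolvent_def op_inverse_def op_add_def op_id_def op_scale_def)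

lemma resolvent_nonexpansive:
  fixes A :: "'a::real_inner setmap"
  assumes mono: "monotone_op A" and c: "c > 0"
    and x: "x \<in> resolvent c A y" and x': "x' \<in> resolvent c A y'"
  shows "norm (x - x') \<le> norm (y - y')"
proof -
  have "0 \<le> inner (x - x') ((1 / c) *\<^sub>R (y - x) - (1 / c) *\<^sub>R (y' - x'))"
    using mono resolvent_memberD[OF c x] resolvent_memberD[OF c x'] by (auto simp: monotone_op_def)
  also have "\<dots> = (inner (x - x') (y - y') - (norm (x - x'))\<^sup>2) / c"
    by (simp add: power2_norm_eq_inner inner_diff_right inner_diff_left diff_divide_distrib)
  finally have "(norm (x - x'))\<^sup>2 \<le> inner (x - x') (y - y')"
    using c by (simp add: zero_le_divide_iff)
  also have "\<dots> \<le> norm (x - x') * norm (y - y')"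
    by (rule norm_cauchy_schwarz)
  finally show ?thesis
    by (cases "x = x'") (auto simp: power2_eq_square)
qed

text \<open>The resolvent is nonexpansive on the set \<open>D\<close> where it is nonempty. It therefore extends
  continuously to the closure of \<open>D\<close>, which is a Borel set whatever \<open>D\<close> is.\<close>

lemma measurable_resolvent:
  fixes A :: "'a::euclidean_space setmap"
  assumes mono: "monotone_op A" and c: "c > 0"
    and Y: "Y \<in> borel_measurable N"
    and X: "\<And>\<omega>. \<omega> \<in> space N \<Longrightarrow> X \<omega> \<in> resolvent c A (Y \<omega>)"
  shows "X \<in> borel_measurable N"
proof -
  define D where "D = {y. resolvent c A y \<noteq> {}}"
  define J where "J y = (SOME x. x \<in> resolvent c A y)" for y
  have J: "J y \<in> resolvent c A y" if "y \<in> D" for y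
    using that unfolding J_def D_def by (auto intro: someI)
  have "1-lipschitz_on D J"
    by (rule lipschitz_onI) (use resolvent_nonexpansive[OF mono c J J] in \<open>auto simp: dist_norm\<close>)
  then obtain K where K: "1-lipschitz_on (closure D) K" "\<And>y. y \<in> D \<Longrightarrow> K y = J y"
    using lipschitz_extend_closure by blast
  have "(\<lambda>y. if y \<in> closure D then K y else 0) \<in> borel_measurable borel"
    using lipschitz_on_continuous_on[OF K(1)] by (intro borel_measurable_continuous_on_if) auto
  from measurable_compose[OF Y this]
  have "(\<lambda>\<omega>. if Y \<omega> \<in> closure D then K (Y \<omega>) else 0) \<in> borel_measurable N" .
  moreover have "X \<omega> = (if Y \<omega> \<in> closure D then K (Y \<omega>) else 0)" if "\<omega> \<in> space N" for \<omega>
  proof -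
    have D: "Y \<omega> \<in> D" using X[OF that] by (auto simp: D_def)
    then have "norm (X \<omega> - J (Y \<omega>)) \<le> norm (Y \<omega> - Y \<omega>)"
      by (intro resolvent_nonexpansive[OF mono c X[OF that] J])
    with D K(2) closure_subset show ?thesis by auto
  qed
  ultimately show ?thesis
    by (simp cong: measurable_cong)
qed

section \<open>The Fenchel-Young gap on the normal cone\<close>

lemma normal_cone_scale:
  assumes "p \<in> normal_cone C z" "0 \<le> k"
  shows "k *\<^sub>R p \<in> normal_cone C z"
  using assms by (auto simp: normal_cone_def mult_nonneg_nonpos split: if_splits)

text \<open>For \<open>q\<close> normal to \<open>C\<close> at \<open>z\<close> the support function of \<open>C\<close> at \<open>q\<close> is attained at \<open>z\<close>, so it is finite and the
  difference defining \<open>h_fun\<close> is a genuine one.\<close>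

lemma fenchel_young_gap:
  assumes z: "q \<in> normal_cone C z"
  shows "ereal (inner q (x - z) - f x) \<le> h_fun f C q"
proof -
  have zC: "z \<in> C" and le: "\<And>u. u \<in> C \<Longrightarrow> inner q u \<le> inner q z"
    using z by (auto simp: normal_cone_def inner_diff_right split: if_splits)
  have "support_fun C q = ereal (inner q z)"
    unfolding support_fun_def
    by (rule antisym) (auto intro!: SUP_least SUP_upper2[of z] simp: zC le)
  moreover have "ereal (inner q x - f x) \<le> fenchel_conjugate f q"
    unfolding fenchel_conjugate_def by (rule SUP_upper) simp
  ultimately show ?thesis
    unfolding h_fun_def
    by (cases "fenchel_conjugate f q") (auto simp: inner_diff_right)
qed

section \<open>The deterministic one-step estimate\<close>

lemma weighted_young:
  fixes x y :: "'a::real_inner"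
  assumes "a > 0"
  shows "2 * inner x y \<le> a * (norm x)\<^sup>2 + (norm y)\<^sup>2 / a"
proof -
  have "0 \<le> (norm (a *\<^sub>R x - y))\<^sup>2 / a" using assms by simp
  also have "(norm (a *\<^sub>R x - y))\<^sup>2 / a = a * (norm x)\<^sup>2 + (norm y)\<^sup>2 / a - 2 * inner x y"
    using assms unfolding power2_norm_eq_inner
    by (simp add: inner_diff_left inner_diff_right inner_commute field_simps)
  finally show ?thesis by simp
qed

lemma norm_diff_power2_le:
  fixes x y :: "'a::real_inner"
  shows "(norm (x - y))\<^sup>2 \<le> 2 * ((norm x)\<^sup>2 + (norm y)\<^sup>2)"
proof -
  have "(norm (x - y))\<^sup>2 + (norm (x + y))\<^sup>2 = 2 * ((norm x)\<^sup>2 + (norm y)\<^sup>2)"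
    by (simp add: power2_norm_eq_inner inner_diff_left inner_diff_right inner_add_left inner_add_right)
  then show ?thesis
    using zero_le_power2[of "norm (x + y)"] by linarith
qed

text \<open>Here \<open>u\<close> and \<open>v\<close> are consecutive iterates, \<open>l\<close> and \<open>b\<close> the step size and the penalty weight, \<open>P\<close> and \<open>g\<close> the
  value and the gradient of the penalty at \<open>u\<close>, \<open>w\<close> the noise, and \<open>H\<close> a bound for the
  Fenchel-Young gap at \<open>(2 / \<theta>) p / b\<close>. The square \<open>\<parallel>v - u\<parallel>\<^sup>2\<close> provided by monotonicity is divided into four parts: \<open>1 - \<theta>\<close> pays for
  the gradient, \<open>\<theta> / 4\<close> each for the noise and for \<open>p\<close>, and \<open>\<theta> / 2\<close> remains on the left.\<close>

lemma forward_backward_step: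
  fixes u v z g w p :: "'a::real_inner"
  assumes th: "0 < \<theta>" "\<theta> < 1" and L: "L > 0" and l: "l > 0" and b: "b > 0" and c: "l * b \<le> c"
    and mono: "0 \<le> inner (v - z) (u - v - l *\<^sub>R (b *\<^sub>R g + w) + l *\<^sub>R p)"
    and gap1: "P + (norm g)\<^sup>2 / (2 * L) \<le> inner g (u - z)"
    and gap2: "(norm g)\<^sup>2 / (2 * L) \<le> P"
    and fy: "inner ((1 / b) *\<^sub>R (2 / \<theta>) *\<^sub>R p) (u - z) - P \<le> H"
  shows "(norm (v - z))\<^sup>2 + \<theta> / 2 * (norm (v - u))\<^sup>2
      + (2 * (1 - \<theta>) / L - c / (1 - \<theta>)) * (l * b * (norm g)\<^sup>2) + \<theta> * (l * b * P)
    \<le> (norm (u - z))\<^sup>2 - 2 * l * inner (u - z) w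
      + 4 / \<theta> * l\<^sup>2 * (norm w)\<^sup>2 + 4 / \<theta> * l\<^sup>2 * (norm p)\<^sup>2 + \<theta> * (l * b * H)"
proof -
  have s1: "(norm (v - z))\<^sup>2 + (norm (v - u))\<^sup>2
      \<le> (norm (u - z))\<^sup>2 - 2 * l * b * inner g (u - z) - 2 * l * b * inner (v - u) g
        - 2 * l * inner (v - u) w - 2 * l * inner (u - z) w
        + 2 * l * inner (v - u) p + 2 * l * inner (u - z) p"
    using mono by (simp add: power2_norm_eq_inner algebra_simps inner_commute)
  have s2: "- (2 * l * b * inner (v - u) g) \<le> (1 - \<theta>) * (norm (v - u))\<^sup>2 + l * b * (c / (1 - \<theta>) * (norm g)\<^sup>2)"
  proof -
    have "2 * inner (v - u) (- (l * b) *\<^sub>R g)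
        \<le> (1 - \<theta>) * (norm (v - u))\<^sup>2 + (norm (- (l * b) *\<^sub>R g))\<^sup>2 / (1 - \<theta>)"
      using th by (intro weighted_young) auto
    moreover have "2 * inner (v - u) (- (l * b) *\<^sub>R g) = - 2 * l * b * inner (v - u) g"
      by simp
    moreover have "(norm (- (l * b) *\<^sub>R g))\<^sup>2 / (1 - \<theta>) = l * b * (l * b / (1 - \<theta>) * (norm g)\<^sup>2)"
      by (simp add: power_mult_distrib power2_eq_square)
    moreover have "l * b * (l * b / (1 - \<theta>) * (norm g)\<^sup>2) \<le> l * b * (c / (1 - \<theta>) * (norm g)\<^sup>2)"
      using l b th c by (intro mult_left_mono mult_right_mono divide_right_mono) auto
    ultimately show ?thesis by linarith
  qed
  have s3: "- (2 * l * inner (v - u) w) \<le> \<theta> / 4 * (norm (v - u))\<^sup>2 + 4 / \<theta> * l\<^sup>2 * (norm w)\<^sup>2"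
    using weighted_young[of "\<theta> / 4" "v - u" "(- l) *\<^sub>R w"] th by (simp add: power_mult_distrib mult.assoc)
  have s4: "2 * l * inner (v - u) p \<le> \<theta> / 4 * (norm (v - u))\<^sup>2 + 4 / \<theta> * l\<^sup>2 * (norm p)\<^sup>2"
    using weighted_young[of "\<theta> / 4" "v - u" "l *\<^sub>R p"] th by (simp add: power_mult_distrib mult.assoc)
  have s5: "2 * l * inner (u - z) p \<le> \<theta> * (l * b * P) + \<theta> * (l * b * H)"
  proof -
    have "2 * inner (u - z) p \<le> \<theta> * b * (P + H)"
      using fy b th by (simp add: field_simps inner_commute)
    from mult_left_mono[OF this, of l] l show ?thesis by (simp add: algebra_simps)
  qed
  have s6: "2 * l * b * ((1 - \<theta>) * (norm g)\<^sup>2 / L + \<theta> * P) \<le> 2 * l * b * inner g (u - z)"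
  proof (rule mult_left_mono)
    have "(norm g)\<^sup>2 / L = 2 * ((norm g)\<^sup>2 / (2 * L))" by simp
    then have "(norm g)\<^sup>2 / L \<le> inner g (u - z)" using gap1 gap2 by linarith
    moreover have "0 \<le> (norm g)\<^sup>2 / (2 * L)" using L by simp
    then have "P \<le> inner g (u - z)" using gap1 by linarith
    ultimately have "(1 - \<theta>) * ((norm g)\<^sup>2 / L) + \<theta> * P \<le> (1 - \<theta>) * inner g (u - z) + \<theta> * inner g (u - z)"
      using th by (intro add_mono mult_left_mono) auto
    then show "(1 - \<theta>) * (norm g)\<^sup>2 / L + \<theta> * P \<le> inner g (u - z)" by (simp add: algebra_simps)
  qed (use l b in auto)
  have s7: "(2 * (1 - \<theta>) / L - c / (1 - \<theta>)) * (l * b * (norm g)\<^sup>2)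
      = 2 * l * b * ((1 - \<theta>) * (norm g)\<^sup>2 / L) - l * b * (c / (1 - \<theta>) * (norm g)\<^sup>2)"
    by (simp add: algebra_simps)
  have s8: "(1 - \<theta>) * (norm (v - u))\<^sup>2 = (norm (v - u))\<^sup>2 - 4 * (\<theta> / 4 * (norm (v - u))\<^sup>2)"
    "\<theta> / 2 * (norm (v - u))\<^sup>2 = 2 * (\<theta> / 4 * (norm (v - u))\<^sup>2)"
    by (simp_all add: algebra_simps)
  have s9: "2 * l * b * ((1 - \<theta>) * (norm g)\<^sup>2 / L + \<theta> * P)
      = 2 * l * b * ((1 - \<theta>) * (norm g)\<^sup>2 / L) + 2 * (\<theta> * (l * b * P))"
    by (simp add: algebra_simps)
  \<comment> \<open>The rest is linear in the monomials; naming them keeps the arithmetic from expanding the products.\<close>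
  have combine: "vz + vu2 + R + LP \<le> uz - T4 + W + Pn + LH"
    if "vz + vu \<le> uz - T1 - T2 - T3 - T4 + T5 + T6" "- T2 \<le> vu1 + G1" "- T3 \<le> Q + W"
      "T5 \<le> Q + Pn" "T6 \<le> LP + LH" "T7 \<le> T1" "R = G2 - G1" "vu1 = vu - 4 * Q" "vu2 = 2 * Q" "T7 = G2 + 2 * LP"
    for vz vu uz T1 T2 T3 T4 T5 T6 T7 vu1 vu2 G1 G2 Q W Pn LP LH R :: real
    using that by linarith
  show ?thesis by (rule combine[OF s1 s2 s3 s4 s5 s6 s7 s8 s9])
qed

section \<open>Quasi-Fejer recursions\<close>

text \<open>Summing the recursion bounds the partial sums of \<open>b\<close>. Dropping \<open>b\<close> shows that \<open>a\<close> minus the accumulated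
  errors is decreasing and bounded below; adding back the convergent error sums gives the limit of \<open>a\<close>.\<close>

lemma quasi_fejer_convergence:
  fixes a b e :: "nat \<Rightarrow> real"
  assumes step: "\<And>n. n \<ge> N \<Longrightarrow> a (Suc n) + b n \<le> a n + e n"
    and a: "\<And>n. 0 \<le> a n" and b: "\<And>n. 0 \<le> b n" and e0: "\<And>n. n \<ge> N \<Longrightarrow> 0 \<le> e n" and e: "summable e"
  shows "convergent a" "summable b"
proof -
  have e': "summable (\<lambda>n. e (n + N))" using e by (simp add: summable_iff_shift)
  have sum: "a (n + N) + (\<Sum>k<n. b (k + N)) \<le> a N + (\<Sum>k<n. e (k + N))" for n
  proof (induction n)
    case (Suc n)
    then show ?case using step[of "n + N"] by simp
  qed simp
  have bd: "(\<Sum>k<n. e (k + N)) \<le> (\<Sum>k. e (k + N))" for n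
    using e' e0 by (intro sum_le_suminf) auto
  have "summable (\<lambda>n. b (n + N))"
  proof (rule summableI_nonneg_bounded)
    show "(\<Sum>k<n. b (k + N)) \<le> a N + (\<Sum>k. e (k + N))" for n
      using sum[of n] bd[of n] a[of "n + N"] by linarith
  qed (rule b)
  then show "summable b" by (simp add: summable_iff_shift)
  define d where "d n = a (n + N) - (\<Sum>k<n. e (k + N))" for n
  have "decseq d"
    by (rule decseq_SucI) (use step b in \<open>simp add: d_def, smt (verit) le_add2\<close>)
  moreover have "- (\<Sum>k. e (k + N)) \<le> d n" for n
    using bd[of n] a[of "n + N"] by (simp add: d_def)
  ultimately obtain l where "d \<longlonglongrightarrow> l" using decseq_convergent by blast
  then have "(\<lambda>n. d n + (\<Sum>k<n. e (k + N))) \<longlonglongrightarrow> l + (\<Sum>k. e (k + N))"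
    using e' by (intro tendsto_add) (auto simp: summable_LIMSEQ)
  then have "(\<lambda>n. a (n + N)) \<longlonglongrightarrow> l + (\<Sum>k. e (k + N))" by (simp add: d_def)
  then show "convergent a" using LIMSEQ_offset convergentI by blast
qed

section \<open>Borel measurability and matrix-vector products\<close>

lemma borel_measurable_vec_nth_comp:
  fixes X :: "'w \<Rightarrow> 'a::real_normed_vector ^ 'n"
  assumes "X \<in> borel_measurable N"
  shows "(\<lambda>\<omega>. X \<omega> $ i) \<in> borel_measurable N"
  by (rule measurable_compose[OF assms], rule borel_measurable_continuous_onI) (intro continuous_intros)

lemma frobenius_norm_eq_norm: "frobenius_norm S = norm S"
  by (simp add: frobenius_norm_def norm_vec_def L2_set_def sum_nonneg)

lemma norm_matrix_vector_mult_le: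
  fixes S :: "real ^ 'm ^ 'd"
  shows "norm (S *v x) \<le> norm S * norm x"
proof -
  have "norm (S *v x) = L2_set (\<lambda>i. \<bar>inner (S $ i) x\<bar>) UNIV"
    by (simp add: norm_vec_def matrix_vector_mul_component)
  also have "\<dots> \<le> L2_set (\<lambda>i. norm (S $ i) * norm x) UNIV"
    by (intro L2_set_mono Cauchy_Schwarz_ineq2) auto
  also have "\<dots> = norm S * norm x"
    by (simp add: L2_set_left_distrib norm_vec_def)
  finally show ?thesis .
qed

lemma bounded_bilinear_matrix_vector_mult:
  "bounded_bilinear ((*v) :: real ^ 'm ^ 'd \<Rightarrow> real ^ 'm \<Rightarrow> real ^ 'd)"
proof
  show "\<exists>K. \<forall>(S :: real ^ 'm ^ 'd) x. norm (S *v x) \<le> norm S * norm x * K"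
    by (rule exI[of _ 1]) (simp add: norm_matrix_vector_mult_le)
qed (simp_all add: matrix_vector_mult_add_rdistrib matrix_vector_right_distrib
      scaleR_matrix_vector_assoc matrix_vector_mult_scaleR)

lemma borel_measurable_matrix_vector_mult:
  fixes S :: "'w \<Rightarrow> real ^ 'm ^ 'd"
  assumes "S \<in> borel_measurable N" "D \<in> borel_measurable N"
  shows "(\<lambda>\<omega>. S \<omega> *v D \<omega>) \<in> borel_measurable N"
  by (rule borel_measurable_continuous_Pair[OF assms])
     (intro bounded_bilinear.continuous_on[OF bounded_bilinear_matrix_vector_mult] continuous_intros)

lemma sigma_sets_vimage_borel:
  fixes f :: "'w \<Rightarrow> 'b::topological_space"
  shows "sigma_sets \<Omega> {f -` B \<inter> \<Omega> | B. B \<in> sets borel} = {f -` B \<inter> \<Omega> | B. B \<in> sets borel}"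
  using sigma_sets_vimage_commute[of f \<Omega> UNIV "sets borel"]
    sets.sigma_sets_eq[of "borel :: 'b measure"] by simp

lemma integrable_nonneg_le:
  fixes f g :: "'w \<Rightarrow> real"
  assumes "integrable M g" "f \<in> borel_measurable M"
    and "\<And>\<omega>. 0 \<le> f \<omega>" "\<And>\<omega>. \<omega> \<in> space M \<Longrightarrow> f \<omega> \<le> g \<omega>"
  shows "integrable M f"
  by (rule Bochner_Integration.integrable_bound[OF assms(1,2)])
     (use assms(3,4) in \<open>force intro!: AE_I2\<close>)

section \<open>Brownian increments\<close>

lemma nn_integral_normal_density:
  "s > 0 \<Longrightarrow> (\<integral>\<^sup>+x. ennreal (normal_density m s x) \<partial>lborel) = 1"
  by (subst nn_integral_eq_integral) (auto simp: integrable_normal_density)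

lemma prod_Basis_vec:
  fixes f :: "real ^ 'n \<Rightarrow> 'b::comm_monoid_mult"
  shows "(\<Prod>b\<in>Basis. f b) = (\<Prod>i\<in>UNIV. f (axis i 1))"
proof -
  have "(Basis :: (real ^ 'n) set) = (\<lambda>i. axis i 1) ` UNIV"
    by (auto simp: Basis_vec_def)
  then show ?thesis
    using prod.reindex[of "\<lambda>i. axis i (1 :: real)" "UNIV :: 'n set" f]
    by (simp add: inj_on_def axis_eq_axis comp_def)
qed

text \<open>The law of one coordinate is obtained by integrating the product density over \<open>{x. x $ j \<in> B}\<close>: the integral
  factorizes over the coordinates, and all factors but the \<open>j\<close>-th are equal to one.\<close>

lemma isotropic_normal_marginal:
  fixes D :: "'w \<Rightarrow> real ^ 'm"
  assumes D: "distributed M lborel D (\<lambda>x. ennreal (\<Prod>i\<in>UNIV. normal_density 0 s (x $ i)))"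
    and s: "s > 0"
  shows "distributed M lborel (\<lambda>\<omega>. D \<omega> $ j) (\<lambda>y. ennreal (normal_density 0 s y))"
proof -
  have Dm: "D \<in> measurable M borel" using D by (simp add: distributed_def)
  have Djm: "(\<lambda>\<omega>. D \<omega> $ j) \<in> borel_measurable M"
    by (rule borel_measurable_vec_nth_comp[OF Dm])
  have "distr M lborel (\<lambda>\<omega>. D \<omega> $ j) = density lborel (\<lambda>y. ennreal (normal_density 0 s y))"
  proof (rule measure_eqI)
    fix B assume "B \<in> sets (distr M lborel (\<lambda>\<omega>. D \<omega> $ j))"
    then have B: "B \<in> sets borel" by simp
    have B': "{x :: real ^ 'm. x $ j \<in> B} \<in> sets borel"
      using measurable_sets[OF borel_measurable_vec_nth_comp[OF measurable_ident_sets[OF refl]] B, of j]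
      by (simp add: vimage_def)
    define f where "f b y = ennreal (normal_density 0 s y) *
        (if b = axis j (1::real) then indicator B y else 1)" for b :: "real ^ 'm" and y :: real
    have fm: "f b \<in> borel_measurable borel" for b
      using B unfolding f_def by measurable
    have "emeasure (distr M lborel (\<lambda>\<omega>. D \<omega> $ j)) B = emeasure (distr M lborel D) {x. x $ j \<in> B}"
      using Djm Dm B B' by (simp add: emeasure_distr vimage_def)
    also have "\<dots> = (\<integral>\<^sup>+x. ennreal (\<Prod>i\<in>UNIV. normal_density 0 s (x $ i)) * indicator {x. x $ j \<in> B} x \<partial>lborel)"
      using D B' by (simp add: distributed_def emeasure_density)
    also have "\<dots> = (\<integral>\<^sup>+x. (\<Prod>b\<in>Basis. f b (x \<bullet> b)) \<partial>lborel)"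
      by (intro nn_integral_cong)
         (auto simp: prod_Basis_vec f_def axis_eq_axis inner_axis prod.distrib prod_ennreal indicator_def)
    also have "\<dots> = (\<Prod>b\<in>Basis. (\<integral>\<^sup>+y. f b y \<partial>lborel))"
      by (rule nn_integral_lborel_prod) (auto intro: fm)
    also have "\<dots> = (\<Prod>i\<in>UNIV. if i = j then (\<integral>\<^sup>+y. ennreal (normal_density 0 s y) * indicator B y \<partial>lborel) else 1)"
      unfolding prod_Basis_vec
      by (intro prod.cong) (auto simp: f_def[abs_def] axis_eq_axis nn_integral_normal_density[OF s])
    also have "\<dots> = emeasure (density lborel (\<lambda>y. ennreal (normal_density 0 s y))) B"
      using B by (simp add: emeasure_density)
    finally show "emeasure (distr M lborel (\<lambda>\<omega>. D \<omega> $ j)) B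
        = emeasure (density lborel (\<lambda>y. ennreal (normal_density 0 s y))) B" .
  qed simp
  then show ?thesis using Djm by (simp add: distributed_def)
qed

context prob_space
begin

lemma brownian_increment_moments:
  fixes W :: "real \<Rightarrow> 'a \<Rightarrow> real ^ 'm" and a b :: real
  assumes W: "brownian_motion M F W" and ab: "0 \<le> a" "a < b"
  shows "integrable M (\<lambda>\<omega>. (W b \<omega> - W a \<omega>) $ j)" "expectation (\<lambda>\<omega>. (W b \<omega> - W a \<omega>) $ j) = 0"
    and "integrable M (\<lambda>\<omega>. (norm (W b \<omega> - W a \<omega>))\<^sup>2)"
    and "expectation (\<lambda>\<omega>. (norm (W b \<omega> - W a \<omega>))\<^sup>2) = CARD('m) * (b - a)"
proof -
  have s: "sqrt (b - a) > 0" using ab by simp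
  have D: "distributed M lborel (\<lambda>\<omega>. (W b \<omega> - W a \<omega>) $ j) (\<lambda>y. ennreal (normal_density 0 (sqrt (b - a)) y))" for j
    by (rule isotropic_normal_marginal[OF _ s]) (use W ab in \<open>auto simp: brownian_motion_def\<close>)
  show int: "integrable M (\<lambda>\<omega>. (W b \<omega> - W a \<omega>) $ j)" for j
    using distributed_integrable_var[OF D] integrable_normal_moment_nz_1[OF s, of 0] by simp
  show exp: "expectation (\<lambda>\<omega>. (W b \<omega> - W a \<omega>) $ j) = 0" for j
    by (rule normal_distributed_expectation[OF s D])
  have sq: "integrable M (\<lambda>\<omega>. ((W b \<omega> - W a \<omega>) $ j)\<^sup>2)" for j
    using distributed_integrable[OF D, of "\<lambda>y. y\<^sup>2"] integrable_normal_moment[OF s, of 0 2] by simp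
  have var: "expectation (\<lambda>\<omega>. ((W b \<omega> - W a \<omega>) $ j)\<^sup>2) = b - a" for j
    using normal_distributed_variance[OF s D[of j]] exp[of j] ab by simp
  have norm2: "(norm x)\<^sup>2 = (\<Sum>j\<in>UNIV. (x $ j)\<^sup>2)" for x :: "real ^ 'm"
    unfolding power2_norm_eq_inner inner_vec_def by (simp add: power2_eq_square)
  show "integrable M (\<lambda>\<omega>. (norm (W b \<omega> - W a \<omega>))\<^sup>2)"
    unfolding norm2 by (intro Bochner_Integration.integrable_sum sq)
  show "expectation (\<lambda>\<omega>. (norm (W b \<omega> - W a \<omega>))\<^sup>2) = CARD('m) * (b - a)"
    unfolding norm2 by (subst Bochner_Integration.integral_sum) (auto simp only: sq var, simp)
qed

text \<open>The increment after time \<open>a\<close> is independent of \<open>F a\<close>, hence of \<open>G\<close>, and it is centred, so the expectation of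
  the product factorizes into \<open>E G * 0\<close>.\<close>

lemma martingale_increment_orthogonal:
  fixes W :: "real \<Rightarrow> 'a \<Rightarrow> real ^ 'm" and a b :: real
  assumes W: "brownian_motion M F W" and F: "subalgebra M (F a)" and ab: "0 \<le> a" "a < b"
    and G: "G \<in> borel_measurable (F a)" "integrable M (G :: 'a \<Rightarrow> real)"
  shows "integrable M (\<lambda>\<omega>. G \<omega> * (W b \<omega> - W a \<omega>) $ j)"
    and "expectation (\<lambda>\<omega>. G \<omega> * (W b \<omega> - W a \<omega>) $ j) = 0"
proof -
  note mom = brownian_increment_moments[OF W ab]
  have ind: "indep_set (sets (F a)) {(\<lambda>\<omega>. W b \<omega> - W a \<omega>) -` B \<inter> space M | B. B \<in> sets borel}"
    using W ab by (auto simp: brownian_motion_def)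
  have G1: "{G -` B \<inter> space M | B. B \<in> sets borel} \<subseteq> sets (F a)"
    using G(1) F by (auto simp: subalgebra_def dest: measurable_sets)
  have A: "sigma_sets (space M) {G -` B \<inter> space M | B. B \<in> sets borel} \<subseteq> sets (F a)"
    using sets.sigma_sets_subset[OF G1] F by (simp add: subalgebra_def)
  have "{(\<lambda>\<omega>. (W b \<omega> - W a \<omega>) $ j) -` B \<inter> space M | B. B \<in> sets borel}
     \<subseteq> {(\<lambda>\<omega>. W b \<omega> - W a \<omega>) -` B \<inter> space M | B. B \<in> sets borel}"
  proof safe
    fix B :: "real set" assume B: "B \<in> sets borel"
    have "{x :: real ^ 'm. x $ j \<in> B} \<in> sets borel"
      using measurable_sets[OF borel_measurable_vec_nth_comp[OF measurable_ident_sets[OF refl]] B, of j]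
      by (simp add: vimage_def)
    then show "\<exists>B'. (\<lambda>\<omega>. (W b \<omega> - W a \<omega>) $ j) -` B \<inter> space M = (\<lambda>\<omega>. W b \<omega> - W a \<omega>) -` B' \<inter> space M \<and> B' \<in> sets borel"
      by (intro exI[of _ "{x. x $ j \<in> B}"]) auto
  qed
  moreover have "sigma_sets (space M) {(\<lambda>\<omega>. (W b \<omega> - W a \<omega>) $ j) -` B \<inter> space M | B. B \<in> sets borel}
      = {(\<lambda>\<omega>. (W b \<omega> - W a \<omega>) $ j) -` B \<inter> space M | B. B \<in> sets borel}"
    by (rule sigma_sets_vimage_borel)
  ultimately have B: "sigma_sets (space M) {(\<lambda>\<omega>. (W b \<omega> - W a \<omega>) $ j) -` B \<inter> space M | B. B \<in> sets borel}
      \<subseteq> {(\<lambda>\<omega>. W b \<omega> - W a \<omega>) -` B \<inter> space M | B. B \<in> sets borel}"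
    by simp
  have "indep_set (sigma_sets (space M) {G -` B \<inter> space M | B. B \<in> sets borel})
      (sigma_sets (space M) {(\<lambda>\<omega>. (W b \<omega> - W a \<omega>) $ j) -` B \<inter> space M | B. B \<in> sets borel})"
    using ind A B unfolding indep_sets2_eq by (meson subset_trans subsetD)
  then have "indep_var borel G borel (\<lambda>\<omega>. (W b \<omega> - W a \<omega>) $ j)"
    using borel_measurable_integrable[OF G(2)] borel_measurable_integrable[OF mom(1), of j]
    unfolding indep_var_eq by blast
  from indep_var_integrable[OF this G(2) mom(1)] indep_var_lebesgue_integral[OF this G(2) mom(1)] mom(2)
  show "integrable M (\<lambda>\<omega>. G \<omega> * (W b \<omega> - W a \<omega>) $ j)"
    and "expectation (\<lambda>\<omega>. G \<omega> * (W b \<omega> - W a \<omega>) $ j) = 0" by simp_all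
qed

text \<open>This collects what the recursion needs about the noise term \<open>S \<Delta>W\<close>: a second moment of order \<open>s\<^sup>2 (b - a)\<close>,
  and orthogonality to every square integrable vector \<open>Y\<close> known at time \<open>a\<close>. The latter is reduced to scalar
  products by expanding \<open>\<langle>Y, S \<Delta>W\<rangle>\<close> into the sum of the \<open>Y\<^sub>i S\<^sub>i\<^sub>j \<Delta>W\<^sub>j\<close>.\<close>

lemma diffusion_increment:
  fixes W :: "real \<Rightarrow> 'a \<Rightarrow> real ^ 'm" and S :: "'a \<Rightarrow> real ^ 'm ^ 'd" and Y :: "'a \<Rightarrow> real ^ 'd"
    and a b s :: real
  assumes W: "brownian_motion M F W" and F: "filtration_nonneg M F" and ab: "0 \<le> a" "a < b"
    and S: "S \<in> borel_measurable (F a)" "\<And>\<omega>. norm (S \<omega>) \<le> s"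
  shows "integrable M (\<lambda>\<omega>. (norm (S \<omega> *v (W b \<omega> - W a \<omega>)))\<^sup>2)"
    and "expectation (\<lambda>\<omega>. (norm (S \<omega> *v (W b \<omega> - W a \<omega>)))\<^sup>2) \<le> s\<^sup>2 * (CARD('m) * (b - a))"
    and "Y \<in> borel_measurable (F a) \<Longrightarrow> integrable M (\<lambda>\<omega>. (norm (Y \<omega>))\<^sup>2) \<Longrightarrow>
          integrable M (\<lambda>\<omega>. inner (Y \<omega>) (S \<omega> *v (W b \<omega> - W a \<omega>)))"
    and "Y \<in> borel_measurable (F a) \<Longrightarrow> integrable M (\<lambda>\<omega>. (norm (Y \<omega>))\<^sup>2) \<Longrightarrow>
          expectation (\<lambda>\<omega>. inner (Y \<omega>) (S \<omega> *v (W b \<omega> - W a \<omega>))) = 0"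
proof -
  have Fa: "subalgebra M (F a)" and Fb: "subalgebra M (F b)"
    using F ab by (auto simp: filtration_nonneg_def)
  note SM = measurable_from_subalg[OF Fa S(1)]
  have "W a \<in> borel_measurable (F a)" "W b \<in> borel_measurable (F b)"
    using W ab by (auto simp: brownian_motion_def)
  then have WM: "W a \<in> borel_measurable M" "W b \<in> borel_measurable M"
    using measurable_from_subalg Fa Fb by blast+
  have s0: "0 \<le> s" using S(2) norm_ge_zero order_trans by blast
  have bd: "(norm (S \<omega> *v (W b \<omega> - W a \<omega>)))\<^sup>2 \<le> s\<^sup>2 * (norm (W b \<omega> - W a \<omega>))\<^sup>2" for \<omega>
  proof -
    have "norm (S \<omega> *v (W b \<omega> - W a \<omega>)) \<le> s * norm (W b \<omega> - W a \<omega>)"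
      using norm_matrix_vector_mult_le[of "S \<omega>"] mult_right_mono[OF S(2) norm_ge_zero] order_trans by blast
    from power_mono[OF this norm_ge_zero, of 2] show ?thesis by (simp add: power_mult_distrib)
  qed
  have meas: "(\<lambda>\<omega>. (norm (S \<omega> *v (W b \<omega> - W a \<omega>)))\<^sup>2) \<in> borel_measurable M"
    using borel_measurable_matrix_vector_mult[OF SM borel_measurable_diff[OF WM(2) WM(1)]] by measurable
  have dom: "integrable M (\<lambda>\<omega>. s\<^sup>2 * (norm (W b \<omega> - W a \<omega>))\<^sup>2)"
    using brownian_increment_moments(3)[OF W ab] by simp
  show int: "integrable M (\<lambda>\<omega>. (norm (S \<omega> *v (W b \<omega> - W a \<omega>)))\<^sup>2)"
    by (rule Bochner_Integration.integrable_bound[OF dom meas]) (use bd in auto)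
  show "expectation (\<lambda>\<omega>. (norm (S \<omega> *v (W b \<omega> - W a \<omega>)))\<^sup>2) \<le> s\<^sup>2 * (CARD('m) * (b - a))"
    using integral_mono[OF int dom bd] brownian_increment_moments(4)[OF W ab] by simp
  assume Y: "Y \<in> borel_measurable (F a)" "integrable M (\<lambda>\<omega>. (norm (Y \<omega>))\<^sup>2)"
  have G: "(\<lambda>\<omega>. Y \<omega> $ i * S \<omega> $ i $ j) \<in> borel_measurable (F a)" for i j
    by (intro borel_measurable_times borel_measurable_vec_nth_comp Y(1) S(1))
  have Gint: "integrable M (\<lambda>\<omega>. Y \<omega> $ i * S \<omega> $ i $ j)" for i j
  proof (rule Bochner_Integration.integrable_bound)
    show "integrable M (\<lambda>\<omega>. s * (1 + (norm (Y \<omega>))\<^sup>2))" using Y(2) by simp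
    show "(\<lambda>\<omega>. Y \<omega> $ i * S \<omega> $ i $ j) \<in> borel_measurable M"
      by (rule measurable_from_subalg[OF Fa G])
    have "\<bar>Y \<omega> $ i * S \<omega> $ i $ j\<bar> \<le> s * (1 + (norm (Y \<omega>))\<^sup>2)" for \<omega>
    proof -
      have "\<bar>S \<omega> $ i $ j\<bar> \<le> s"
        using component_le_norm_cart[of "S \<omega> $ i" j] Finite_Cartesian_Product.norm_nth_le[of "S \<omega>" i] S(2)[of \<omega>] by linarith
      moreover have "norm (Y \<omega>) \<le> 1 + (norm (Y \<omega>))\<^sup>2"
        using zero_le_power2[of "norm (Y \<omega>) - 1"] norm_ge_zero[of "Y \<omega>"]
        unfolding power2_diff one_power2 by linarith
      then have "\<bar>Y \<omega> $ i\<bar> \<le> 1 + (norm (Y \<omega>))\<^sup>2"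
        using component_le_norm_cart[of "Y \<omega>" i] by linarith
      ultimately show ?thesis
        unfolding abs_mult by (subst mult.commute) (intro mult_mono, auto simp: s0)
    qed
    then show "AE \<omega> in M. norm (Y \<omega> $ i * S \<omega> $ i $ j) \<le> norm (s * (1 + (norm (Y \<omega>))\<^sup>2))"
      by (intro AE_I2) (smt (verit) real_norm_def)
  qed
  have expand: "inner (Y \<omega>) (S \<omega> *v (W b \<omega> - W a \<omega>))
      = (\<Sum>i\<in>UNIV. \<Sum>j\<in>UNIV. (Y \<omega> $ i * S \<omega> $ i $ j) * (W b \<omega> - W a \<omega>) $ j)" for \<omega>
    by (simp add: inner_vec_def matrix_vector_mult_def sum_distrib_left mult.assoc)
  note orth = martingale_increment_orthogonal[OF W Fa ab G Gint]
  show "integrable M (\<lambda>\<omega>. inner (Y \<omega>) (S \<omega> *v (W b \<omega> - W a \<omega>)))"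
    unfolding expand by (intro Bochner_Integration.integrable_sum orth(1))
  show "expectation (\<lambda>\<omega>. inner (Y \<omega>) (S \<omega> *v (W b \<omega> - W a \<omega>))) = 0"
    unfolding expand
    by (subst Bochner_Integration.integral_sum, intro Bochner_Integration.integrable_sum orth(1),
        subst Bochner_Integration.integral_sum, intro orth(1), simp only: orth(2), simp)
qed

end

section \<open>From summable expectations to almost sure convergence\<close>

text \<open>By monotone convergence the expectation of the series of the \<open>f n\<close> is finite, so the series is finite almost
  surely.\<close>

lemma AE_tendsto_zero_of_summable_integral:
  fixes f :: "nat \<Rightarrow> 'w \<Rightarrow> real"
  assumes int: "\<And>n. integrable M (f n)" and nn: "\<And>n \<omega>. 0 \<le> f n \<omega>"
    and sum: "summable (\<lambda>n. \<integral>\<omega>. f n \<omega> \<partial>M)"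
  shows "AE \<omega> in M. (\<lambda>n. f n \<omega>) \<longlonglongrightarrow> 0"
proof -
  have [measurable]: "f n \<in> borel_measurable M" for n using int by auto
  have "(\<integral>\<^sup>+\<omega>. (\<Sum>n. ennreal (f n \<omega>)) \<partial>M) = (\<Sum>n. \<integral>\<^sup>+\<omega>. ennreal (f n \<omega>) \<partial>M)"
    by (rule nn_integral_suminf) measurable
  also have "\<dots> = (\<Sum>n. ennreal (\<integral>\<omega>. f n \<omega> \<partial>M))"
    using int nn by (simp add: nn_integral_eq_integral)
  also have "\<dots> \<noteq> \<infinity>"
    using sum nn by (simp add: suminf_ennreal2 integral_nonneg_AE)
  finally have "AE \<omega> in M. (\<Sum>n. ennreal (f n \<omega>)) \<noteq> \<infinity>"
    by (intro nn_integral_PInf_AE) auto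
  then show ?thesis
    by eventually_elim (use nn in \<open>auto intro!: summable_LIMSEQ_zero summable_suminf_not_top\<close>)
qed

section \<open>Convergence of the stochastic forward-backward penalty scheme\<close>

theorem theorem5p4:
  fixes A :: "(real ^ 'd) setmap"
    and C :: "(real ^ 'd) set"
    and \<Psi> :: "real ^ 'd \<Rightarrow> real"
    and grad\<Psi> :: "real ^ 'd \<Rightarrow> real ^ 'd"
    and L :: real
    and t :: "nat \<Rightarrow> real"
    and \<beta> :: "real \<Rightarrow> real"
    and lam bet s :: "nat \<Rightarrow> real"
    and M :: "'w measure"
    and F :: "real \<Rightarrow> 'w measure"
    and W :: "real \<Rightarrow> 'w \<Rightarrow> real ^ 'm"
    and \<sigma> :: "real \<Rightarrow> real ^ 'd \<Rightarrow> real ^ 'm ^ 'd"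
    and \<xi> :: "'w \<Rightarrow> real ^ 'd"
    and X V :: "nat \<Rightarrow> 'w \<Rightarrow> real ^ 'd"
  assumes A: "maximally_monotone A"
    and C: "C \<noteq> {}" "closed C" "convex C"
    and int_dom: "interior (op_dom A) \<noteq> {}"
    and sum_max: "maximally_monotone (op_add A (normal_cone C))"
    and zer_nonempty: "op_zer (op_add A (normal_cone C)) \<noteq> {}"
    and Psi_convex: "convex_on UNIV \<Psi>"
    and Psi_grad: "\<And>x. GDERIV \<Psi> x :> grad\<Psi> x"
    and grad_cont: "continuous_on UNIV grad\<Psi>"
    and L_pos: "L > 0"
    and grad_lipschitz: "L-lipschitz_on UNIV grad\<Psi>"
    and C_zero: "C = {x. \<Psi> x = 0}"
    and C_argmin: "C = {x. is_arg_min \<Psi> (\<lambda>_. True) x}"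
    and t: "t 0 = 0" "strict_mono t"
    and beta_pos: "\<And>r. 0 \<le> r \<Longrightarrow> 0 < \<beta> r"
    and beta_mono: "mono_on {0..} \<beta>"
    and beta_ac: "locally_abs_continuous_nonneg \<beta>"
    and lam: "\<And>n. lam n = t (Suc n) - t n"
    and bet: "\<And>n. bet n = \<beta> (t n)"
    and M: "prob_space M"
    and F: "filtration_nonneg M F"
    and W: "brownian_motion M F W"
    and sigma_meas: "(\<lambda>(r, x). \<sigma> r x) \<in> borel_measurable (restrict_space borel ({0..} \<times> UNIV))"
    and xi_meas: "\<xi> \<in> borel_measurable (F 0)"
    and xi_L2: "integrable M (\<lambda>\<omega>. (norm (\<xi> \<omega>))\<^sup>2)"
    and xi_dom: "AE \<omega> in M. \<xi> \<omega> \<in> closure (op_dom A)"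
    and X_0: "\<And>\<omega>. \<omega> \<in> space M \<Longrightarrow> X 0 \<omega> = \<xi> \<omega>"
    and V_Suc: "\<And>n \<omega>. \<omega> \<in> space M \<Longrightarrow>
      V (Suc n) \<omega> =
        bet n *\<^sub>R grad\<Psi> (X n \<omega>) + \<sigma> (t n) (X n \<omega>) *v (W (t (Suc n)) \<omega> - W (t n) \<omega>)"
    and X_Suc: "\<And>n \<omega>. \<omega> \<in> space M \<Longrightarrow>
      resolvent (lam n) A (X n \<omega> - lam n *\<^sub>R V (Suc n) \<omega>) = {X (Suc n) \<omega>}"
    and limsup_step: "limsup (\<lambda>n. ereal (lam n * bet n)) < ereal (2 / L)"
    and h_sum: "\<And>p. p \<in> op_range (normal_cone C) \<Longrightarrow>
      (\<Sum>n. ereal (lam (Suc n) * bet (Suc n)) * h_fun \<Psi> C ((1 / bet (Suc n)) *\<^sub>R p)) < \<infinity>"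
    and s_nonneg: "\<And>n. 0 \<le> s n"
    and sigma_bound: "\<And>n. (SUP x. ereal ((frobenius_norm (\<sigma> (t n) x))\<^sup>2)) \<le> ereal ((s n)\<^sup>2)"
    and lam_sum: "summable (\<lambda>n. (lam (Suc n))\<^sup>2)"
    and s_sum: "summable (\<lambda>n. lam (Suc n) * (s (Suc n))\<^sup>2)"
  shows
    "(\<forall>z \<in> op_zer (op_add A (normal_cone C)).
        (\<forall>n. integrable M (\<lambda>\<omega>. (norm (X n \<omega> - z))\<^sup>2)) \<and>
        (\<exists>l. (\<lambda>n. \<integral>\<omega>. (norm (X n \<omega> - z))\<^sup>2 \<partial>M) \<longlonglongrightarrow> l)) \<and>
     ((\<forall>n. integrable M (\<lambda>\<omega>. (norm (X (Suc n) \<omega> - X n \<omega>))\<^sup>2)) \<and>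
      (\<lambda>n. \<integral>\<omega>. (norm (X (Suc n) \<omega> - X n \<omega>))\<^sup>2 \<partial>M) \<longlonglongrightarrow> 0 \<and>
      (\<forall>n. integrable M (\<lambda>\<omega>. lam n * bet n * \<Psi> (X n \<omega>))) \<and>
      (\<lambda>n. \<integral>\<omega>. lam n * bet n * \<Psi> (X n \<omega>) \<partial>M) \<longlonglongrightarrow> 0 \<and>
      (\<forall>n. integrable M (\<lambda>\<omega>. lam n * bet n * (norm (grad\<Psi> (X n \<omega>)))\<^sup>2)) \<and>
      (\<lambda>n. \<integral>\<omega>. lam n * bet n * (norm (grad\<Psi> (X n \<omega>)))\<^sup>2 \<partial>M) \<longlonglongrightarrow> 0) \<and>
     ((INF n\<in>{1..}. lam n * bet n) > 0 \<longrightarrow>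
      (AE \<omega> in M. (\<lambda>n. \<Psi> (X n \<omega>)) \<longlonglongrightarrow> 0 \<and> (\<lambda>n. norm (grad\<Psi> (X n \<omega>))) \<longlonglongrightarrow> 0))"
proof -
  interpret prob_space M by (rule M)

  have mono: "monotone_op A" using A by (simp add: maximally_monotone_def)
  have t_nonneg: "0 \<le> t n" for n
    using t strict_mono_less_eq[OF t(2), of 0 n] by simp
  have t_less: "t n < t (Suc n)" for n
    using t(2) by (simp add: strict_mono_less)
  have lam_pos: "0 < lam n" for n using t_less[of n] by (simp add: lam)
  have bet_pos: "0 < bet n" for n using beta_pos[OF t_nonneg] by (simp add: bet)

  have subalg: "subalgebra M (F (t n))" for n
    using F t_nonneg by (simp add: filtration_nonneg_def)
  have space_F: "space (F (t n)) = space M" for n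
    using subalg by (simp add: subalgebra_def)
  have F_mono: "f \<in> borel_measurable (F (t (Suc n)))" if "f \<in> borel_measurable (F (t n))"
    for f :: "'w \<Rightarrow> 'z::topological_space" and n
  proof (rule measurable_from_subalg[OF _ that])
    show "subalgebra (F (t (Suc n))) (F (t n))"
      using F t_nonneg[of n] t_less[of n] unfolding filtration_nonneg_def by auto
  qed
  have W_meas: "W (t n) \<in> borel_measurable (F (t n))" for n
    using W t_nonneg by (simp add: brownian_motion_def)

  have sigma_le: "norm (\<sigma> (t n) x) \<le> s n" for n x
  proof -
    have "ereal ((frobenius_norm (\<sigma> (t n) x))\<^sup>2) \<le> (SUP x. ereal ((frobenius_norm (\<sigma> (t n) x))\<^sup>2))"
      by (rule SUP_upper) simp
    also have "\<dots> \<le> ereal ((s n)\<^sup>2)" by (rule sigma_bound)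
    finally have "(norm (\<sigma> (t n) x))\<^sup>2 \<le> (s n)\<^sup>2"
      unfolding frobenius_norm_eq_norm ereal_less_eq .
    then show ?thesis by (rule power2_le_imp_le[OF _ s_nonneg])
  qed
  have sigma_borel: "\<sigma> (t n) \<in> borel_measurable borel" for n
  proof -
    have "(\<lambda>x. (t n, x)) \<in> measurable borel (restrict_space borel ({0..} \<times> UNIV))"
      by (intro measurable_restrict_space2 borel_measurable_continuous_onI)
         (auto intro!: continuous_intros simp: t_nonneg)
    from measurable_compose[OF this sigma_meas] show ?thesis by simp
  qed
  have grad_borel: "grad\<Psi> \<in> borel_measurable borel"
    by (rule borel_measurable_continuous_onI[OF grad_cont])
  have "continuous_on UNIV \<Psi>"
    using Psi_grad by (auto simp: gderiv_def continuous_on_eq_continuous_at intro: has_derivative_continuous)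
  then have Psi_borel: "\<Psi> \<in> borel_measurable borel"
    by (rule borel_measurable_continuous_onI)

  define w where "w n \<omega> = \<sigma> (t n) (X n \<omega>) *v (W (t (Suc n)) \<omega> - W (t n) \<omega>)" for n \<omega>
  define Y where "Y n \<omega> = X n \<omega> - lam n *\<^sub>R (bet n *\<^sub>R grad\<Psi> (X n \<omega>) + w n \<omega>)" for n \<omega>
  have X_res: "X (Suc n) \<omega> \<in> resolvent (lam n) A (Y n \<omega>)" if "\<omega> \<in> space M" for n \<omega>
    using X_Suc[OF that, of n] V_Suc[OF that, of n] by (simp add: Y_def w_def)

  have adapted: "X n \<in> borel_measurable (F (t n))" for n
  proof (induction n)
    case 0
    have "X 0 \<in> borel_measurable (F (t 0)) \<longleftrightarrow> \<xi> \<in> borel_measurable (F (t 0))"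
      by (rule measurable_cong) (simp add: X_0 space_F)
    then show ?case using xi_meas t(1) by simp
  next
    case (Suc n)
    have w: "w n \<in> borel_measurable (F (t (Suc n)))"
      unfolding w_def
      by (intro borel_measurable_matrix_vector_mult borel_measurable_diff W_meas F_mono[OF W_meas]
          F_mono measurable_compose[OF Suc sigma_borel])
    have Y: "Y n \<in> borel_measurable (F (t (Suc n)))"
      unfolding Y_def
      by (intro borel_measurable_diff borel_measurable_scaleR borel_measurable_add borel_measurable_const
          w F_mono[OF Suc] F_mono[OF measurable_compose[OF Suc grad_borel]])
    show ?case
      by (rule measurable_resolvent[OF mono lam_pos[of n] Y]) (simp add: X_res space_F)
  qed
  have X_meas [measurable]: "X n \<in> borel_measurable M" for n
    by (rule measurable_from_subalg[OF subalg adapted])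
  have grad_meas [measurable]: "(\<lambda>\<omega>. grad\<Psi> (X n \<omega>)) \<in> borel_measurable M" for n
    by (rule measurable_compose[OF X_meas grad_borel])
  have Psi_meas [measurable]: "(\<lambda>\<omega>. \<Psi> (X n \<omega>)) \<in> borel_measurable M" for n
    by (rule measurable_compose[OF X_meas Psi_borel])

  note diffusion = diffusion_increment[OF W F t_nonneg t_less measurable_compose[OF adapted sigma_borel] sigma_le]
  have noise_int: "integrable M (\<lambda>\<omega>. (norm (w n \<omega>))\<^sup>2)"
    and noise_le: "expectation (\<lambda>\<omega>. (norm (w n \<omega>))\<^sup>2) \<le> (s n)\<^sup>2 * (CARD('m) * lam n)" for n
    unfolding w_def lam by (rule diffusion)+
  have cross_int: "integrable M (\<lambda>\<omega>. inner (Z \<omega>) (w n \<omega>))"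
    and cross_zero: "expectation (\<lambda>\<omega>. inner (Z \<omega>) (w n \<omega>)) = 0"
    if "Z \<in> borel_measurable (F (t n))" "integrable M (\<lambda>\<omega>. (norm (Z \<omega>))\<^sup>2)" for Z n
    unfolding w_def by (rule diffusion(3)[OF that], rule diffusion(4)[OF that])

  have gap_lower: "\<Psi> x + (norm (grad\<Psi> x))\<^sup>2 / (2 * L) \<le> inner (grad\<Psi> x) (x - z)"
    and gap_upper: "(norm (grad\<Psi> x))\<^sup>2 / (2 * L) \<le> \<Psi> x"
    and grad_le: "norm (grad\<Psi> x) \<le> L * norm (x - z)" if "z \<in> C" for x z
  proof -
    have Psi_z: "\<Psi> z = 0" using that C_zero by simp
    have "\<Psi> z \<le> \<Psi> y" for y
      using that unfolding C_argmin by (auto simp: is_arg_min_linorder)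
    \<comment> \<open>A gradient step of length \<open>1 / L\<close> from the minimizer \<open>z\<close> would decrease \<open>\<Psi>\<close> unless the gradient vanished.\<close>
    have "grad\<Psi> z = 0"
    proof -
      define y where "y = z - (1 / L) *\<^sub>R grad\<Psi> z"
      have "\<Psi> z \<le> \<Psi> z + inner (grad\<Psi> z) (y - z) + L / 2 * (norm (y - z))\<^sup>2"
        using \<open>\<Psi> z \<le> \<Psi> y\<close> descent_lemma[OF Psi_grad grad_lipschitz, of y z] by simp
      also have "\<dots> = \<Psi> z - (norm (grad\<Psi> z))\<^sup>2 / (2 * L)"
        using L_pos by (simp add: y_def power2_norm_eq_inner[symmetric] power_divide power2_eq_square[of L] field_simps)
      finally have "(norm (grad\<Psi> z))\<^sup>2 / (2 * L) \<le> 0" by simp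
      then show ?thesis using L_pos by (simp add: divide_le_0_iff)
    qed
    with Psi_z convex_smooth_gradient_gap[OF Psi_convex Psi_grad L_pos grad_lipschitz, of x z]
      convex_smooth_gradient_gap[OF Psi_convex Psi_grad L_pos grad_lipschitz, of z x]
    show "\<Psi> x + (norm (grad\<Psi> x))\<^sup>2 / (2 * L) \<le> inner (grad\<Psi> x) (x - z)"
      "(norm (grad\<Psi> x))\<^sup>2 / (2 * L) \<le> \<Psi> x"
      by (simp_all add: inner_diff_right)
    show "norm (grad\<Psi> x) \<le> L * norm (x - z)"
      using lipschitz_onD[OF grad_lipschitz, of x z] \<open>grad\<Psi> z = 0\<close> by (simp add: dist_norm)
  qed
  have Psi_nonneg: "0 \<le> \<Psi> x" for x
  proof -
    obtain u where u: "u \<in> C" using C(1) by blast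
    then have "is_arg_min \<Psi> (\<lambda>_. True) u" using C_argmin by blast
    then have "\<Psi> u \<le> \<Psi> x" by (simp add: is_arg_min_linorder)
    then show ?thesis using u C_zero by simp
  qed

  obtain c where c: "limsup (\<lambda>n. ereal (lam n * bet n)) < ereal c" "ereal c < ereal (2 / L)"
    using ereal_dense2[OF limsup_step] by blast
  have "eventually (\<lambda>n. lam n * bet n \<le> c) sequentially"
    using Limsup_lessD[OF c(1)] by eventually_elim simp
  then obtain N0 where N0: "\<And>n. n \<ge> N0 \<Longrightarrow> lam n * bet n \<le> c"
    by (auto simp: eventually_sequentially)
  \<comment> \<open>The series of the values of \<open>h_fun\<close> controls only the indices from one on, so the recursion starts there at the earliest.\<close>
  define N where "N = max 1 N0"
  have c_pos: "0 < c" using N0[of N0] mult_pos_pos[OF lam_pos[of N0] bet_pos[of N0]] by linarith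
  \<comment> \<open>The leftover weight \<open>\<delta>\<close> of the gradient term is positive iff \<open>r < (1 - \<theta>)\<^sup>2\<close>; the choice of \<open>\<theta>\<close> makes
    \<open>(1 - \<theta>)\<^sup>2\<close> equal to \<open>r + \<theta>\<^sup>2\<close>.\<close>
  define r where "r = c * L / 2"
  define \<theta> where "\<theta> = (1 - r) / 2"
  define \<delta> where "\<delta> = 2 * (1 - \<theta>) / L - c / (1 - \<theta>)"
  have r: "0 < r" "r < 1"
    using c(2) c_pos L_pos by (simp_all add: r_def field_simps)
  then have th: "0 < \<theta>" "\<theta> < 1" by (simp_all add: \<theta>_def)
  have "r < (1 - \<theta>)\<^sup>2"
  proof -
    have "(1 - \<theta>)\<^sup>2 = r + \<theta>\<^sup>2" by (simp add: \<theta>_def power2_eq_square field_simps)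
    then show ?thesis using th by simp
  qed
  then have \<delta>: "0 < \<delta>"
    using th L_pos by (simp add: \<delta>_def r_def field_simps power2_eq_square)

  have main: "(\<forall>n. integrable M (\<lambda>\<omega>. (norm (X n \<omega> - z))\<^sup>2)) \<and>
      (\<forall>n. integrable M (\<lambda>\<omega>. (norm (X (Suc n) \<omega> - X n \<omega>))\<^sup>2)) \<and>
      (\<forall>n. integrable M (\<lambda>\<omega>. lam n * bet n * \<Psi> (X n \<omega>))) \<and>
      (\<forall>n. integrable M (\<lambda>\<omega>. lam n * bet n * (norm (grad\<Psi> (X n \<omega>)))\<^sup>2)) \<and>
      convergent (\<lambda>n. \<integral>\<omega>. (norm (X n \<omega> - z))\<^sup>2 \<partial>M) \<and>
      summable (\<lambda>n. \<theta> / 2 * (\<integral>\<omega>. (norm (X (Suc n) \<omega> - X n \<omega>))\<^sup>2 \<partial>M)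
        + \<delta> * (\<integral>\<omega>. lam n * bet n * (norm (grad\<Psi> (X n \<omega>)))\<^sup>2 \<partial>M)
        + \<theta> * (\<integral>\<omega>. lam n * bet n * \<Psi> (X n \<omega>) \<partial>M))"
    if z: "z \<in> op_zer (op_add A (normal_cone C))" for z
  proof -
    from z obtain u p where "u \<in> A z" and p: "p \<in> normal_cone C z" and "u + p = 0"
      by (auto simp: op_zer_def op_add_def)
    then have Az: "- p \<in> A z" by (metis add_eq_0_iff2)
    have zC: "z \<in> C" using p by (simp add: normal_cone_def split: if_splits)

    \<comment> \<open>Square integrability is passed on by nonexpansiveness of the resolvent, because \<open>z\<close> is itself a value of
      it, namely at \<open>z - \<lambda>\<^sub>n p\<close>.\<close>
    have distY: "norm (X (Suc n) \<omega> - z) \<le> (1 + lam n * bet n * L) * norm (X n \<omega> - z) + lam n * norm p + lam n * norm (w n \<omega>)"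
      if "\<omega> \<in> space M" for n \<omega>
    proof -
      have "norm (X (Suc n) \<omega> - z) \<le> norm (Y n \<omega> - (z + lam n *\<^sub>R (- p)))"
        by (rule resolvent_nonexpansive[OF mono lam_pos X_res[OF that] resolvent_memberI[where A = A, OF Az]])
      also have "Y n \<omega> - (z + lam n *\<^sub>R (- p))
          = (X n \<omega> - z) + (- ((lam n * bet n) *\<^sub>R grad\<Psi> (X n \<omega>))) + lam n *\<^sub>R p + (- (lam n *\<^sub>R w n \<omega>))"
        by (simp add: Y_def algebra_simps)
      also have "norm \<dots> \<le> norm (X n \<omega> - z) + norm (- ((lam n * bet n) *\<^sub>R grad\<Psi> (X n \<omega>)))
          + norm (lam n *\<^sub>R p) + norm (- (lam n *\<^sub>R w n \<omega>))"
        by (intro norm_triangle_mono order_refl)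
      also have "\<dots> = norm (X n \<omega> - z) + lam n * bet n * norm (grad\<Psi> (X n \<omega>)) + lam n * norm p + lam n * norm (w n \<omega>)"
        using lam_pos[of n] bet_pos[of n] by simp
      also have "lam n * bet n * norm (grad\<Psi> (X n \<omega>)) \<le> lam n * bet n * (L * norm (X n \<omega> - z))"
        using grad_le[OF zC] lam_pos[of n] bet_pos[of n] by (intro mult_left_mono) auto
      finally show ?thesis by (simp add: algebra_simps)
    qed
    have sq3: "(x + y + v)\<^sup>2 \<le> 3 * (x\<^sup>2 + y\<^sup>2 + v\<^sup>2)" for x y v :: real
      using zero_le_power2[of "x - y"] zero_le_power2[of "y - v"] zero_le_power2[of "x - v"]
      by (simp add: power2_eq_square algebra_simps)
    have L2: "integrable M (\<lambda>\<omega>. (norm (X n \<omega> - z))\<^sup>2)" for n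
    proof (induction n)
      case 0
      have bound: "integrable M (\<lambda>\<omega>. 2 * ((norm (\<xi> \<omega>))\<^sup>2 + (norm z)\<^sup>2))" using xi_L2 by simp
      have le: "(norm (X 0 \<omega> - z))\<^sup>2 \<le> 2 * ((norm (\<xi> \<omega>))\<^sup>2 + (norm z)\<^sup>2)" if "\<omega> \<in> space M" for \<omega>
        using norm_diff_power2_le[of "\<xi> \<omega>" z] by (simp add: X_0[OF that])
      show ?case
        by (rule integrable_nonneg_le[OF bound _ zero_le_power2 le]) simp_all
    next
      case (Suc n)
      have bound: "integrable M (\<lambda>\<omega>. 3 * ((1 + lam n * bet n * L)\<^sup>2 * (norm (X n \<omega> - z))\<^sup>2
          + (lam n * norm p)\<^sup>2 + (lam n)\<^sup>2 * (norm (w n \<omega>))\<^sup>2))"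
        using Suc noise_int[of n] by simp
      have le: "(norm (X (Suc n) \<omega> - z))\<^sup>2 \<le> 3 * ((1 + lam n * bet n * L)\<^sup>2 * (norm (X n \<omega> - z))\<^sup>2
          + (lam n * norm p)\<^sup>2 + (lam n)\<^sup>2 * (norm (w n \<omega>))\<^sup>2)" if "\<omega> \<in> space M" for \<omega>
        using order_trans[OF power_mono[OF distY[OF that, of n] norm_ge_zero, of 2] sq3]
        by (simp add: power_mult_distrib)
      show ?case
        by (rule integrable_nonneg_le[OF bound _ zero_le_power2 le]) simp_all
    qed
    have intD: "integrable M (\<lambda>\<omega>. (norm (X (Suc n) \<omega> - X n \<omega>))\<^sup>2)" for n
    proof (rule integrable_nonneg_le)
      show "integrable M (\<lambda>\<omega>. 2 * ((norm (X (Suc n) \<omega> - z))\<^sup>2 + (norm (X n \<omega> - z))\<^sup>2))"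
        using L2[of n] L2[of "Suc n"] by simp
      show "(norm (X (Suc n) \<omega> - X n \<omega>))\<^sup>2 \<le> 2 * ((norm (X (Suc n) \<omega> - z))\<^sup>2 + (norm (X n \<omega> - z))\<^sup>2)" for \<omega>
        using norm_diff_power2_le[of "X (Suc n) \<omega> - z" "X n \<omega> - z"] by simp
    qed auto
    have grad_sq: "(norm (grad\<Psi> x))\<^sup>2 \<le> L\<^sup>2 * (norm (x - z))\<^sup>2" for x
      using power_mono[OF grad_le[OF zC, of x] norm_ge_zero, of 2] by (simp add: power_mult_distrib)
    have intG: "integrable M (\<lambda>\<omega>. (norm (grad\<Psi> (X n \<omega>)))\<^sup>2)" for n
    proof (rule integrable_nonneg_le)
      show "integrable M (\<lambda>\<omega>. L\<^sup>2 * (norm (X n \<omega> - z))\<^sup>2)" using L2[of n] by simp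
    qed (use grad_sq in auto)
    have Psi_sq: "\<Psi> x \<le> L * (norm (x - z))\<^sup>2" for x
    proof -
      have "0 \<le> (norm (grad\<Psi> x))\<^sup>2 / (2 * L)" using L_pos by simp
      then have "\<Psi> x \<le> inner (grad\<Psi> x) (x - z)" using gap_lower[OF zC, of x] by linarith
      also have "\<dots> \<le> norm (grad\<Psi> x) * norm (x - z)" by (rule norm_cauchy_schwarz)
      also have "\<dots> \<le> L * norm (x - z) * norm (x - z)"
        by (intro mult_right_mono grad_le[OF zC]) simp
      finally show ?thesis by (simp add: power2_eq_square mult.assoc)
    qed
    have intP: "integrable M (\<lambda>\<omega>. \<Psi> (X n \<omega>))" for n
    proof (rule integrable_nonneg_le)
      show "integrable M (\<lambda>\<omega>. L * (norm (X n \<omega> - z))\<^sup>2)" using L2[of n] by simp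
    qed (use Psi_sq Psi_nonneg in auto)

    define h where "h n = h_fun \<Psi> C ((1 / bet n) *\<^sub>R (2 / \<theta>) *\<^sub>R p)" for n
    define H where "H n = real_of_ereal (h n)" for n
    have cone: "(1 / bet n) *\<^sub>R (2 / \<theta>) *\<^sub>R p \<in> normal_cone C z" for n
      using bet_pos[of n] th by (intro normal_cone_scale p) auto
    have h_nonneg: "0 \<le> h n" for n
      using fenchel_young_gap[OF cone, of n z \<Psi>] zC C_zero by (simp add: h_def zero_ereal_def)
    have h_series: "(\<Sum>n. ereal (lam (Suc n) * bet (Suc n)) * h (Suc n)) \<noteq> \<infinity>"
    proof -
      have "(2 / \<theta>) *\<^sub>R p \<in> op_range (normal_cone C)"
        unfolding op_range_def using normal_cone_scale[OF p, of "2 / \<theta>"] th by auto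
      from h_sum[OF this] show ?thesis by (simp add: h_def)
    qed
    have lb_pos: "0 < lam n * bet n" for n using lam_pos bet_pos by simp
    have h_term: "0 \<le> ereal (lam (Suc n) * bet (Suc n)) * h (Suc n)" for n
      using lb_pos[of "Suc n"] h_nonneg by (intro ereal_0_le_mult) (auto simp: less_imp_le)
    have h_fin: "h n = ereal (H n)" if "n \<ge> 1" for n
    proof -
      obtain k where n: "n = Suc k" using \<open>n \<ge> 1\<close> by (cases n) auto
      have "ereal (lam n * bet n) * h n \<noteq> \<infinity>"
        using suminf_PInfty[OF h_term h_series, of k] n by simp
      then show ?thesis
        using lb_pos[of n] h_nonneg[of n] unfolding H_def by (cases "h n") (auto split: if_splits)
    qed
    have H_sum: "summable (\<lambda>n. lam n * bet n * H n)"
    proof -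
      have "summable (\<lambda>n. real_of_ereal (ereal (lam (Suc n) * bet (Suc n)) * h (Suc n)))"
        by (rule summable_real_of_ereal[OF h_term h_series])
      then show ?thesis
        by (subst summable_Suc_iff[symmetric]) (simp add: H_def)
    qed

    define e where "e n = 4 / \<theta> * (lam n)\<^sup>2 * ((s n)\<^sup>2 * (CARD('m) * lam n)) + 4 / \<theta> * (lam n)\<^sup>2 * (norm p)\<^sup>2
        + \<theta> * (lam n * bet n * H n)" for n
    have e_nonneg: "0 \<le> e n" if "n \<ge> N" for n
    proof -
      have "0 \<le> H n" using h_nonneg[of n] h_fin[of n] that by (simp add: N_def)
      then show ?thesis
        using th lam_pos[of n] bet_pos[of n] by (simp add: e_def)
    qed
    \<comment> \<open>The square summability of the step sizes bounds them, which reduces the noise term of order \<open>\<lambda>\<^sub>n\<^sup>3 s\<^sub>n\<^sup>2\<close> to \<open>\<lambda>\<^sub>n s\<^sub>n\<^sup>2\<close>.\<close>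
    have e_sum: "summable e"
    proof -
      have "Bseq (\<lambda>n. (lam (Suc n))\<^sup>2)"
        using summable_LIMSEQ_zero[OF lam_sum] by (intro convergent_imp_Bseq convergentI)
      then obtain K where K: "\<And>n. \<bar>(lam (Suc n))\<^sup>2\<bar> \<le> K"
        unfolding Bseq_def real_norm_def by blast
      have "summable (\<lambda>n. (lam (Suc n))\<^sup>2 * (lam (Suc n) * (s (Suc n))\<^sup>2))"
      proof (rule summable_comparison_test')
        show "summable (\<lambda>n. K * (lam (Suc n) * (s (Suc n))\<^sup>2))" using s_sum by (rule summable_mult)
        show "norm ((lam (Suc n))\<^sup>2 * (lam (Suc n) * (s (Suc n))\<^sup>2)) \<le> K * (lam (Suc n) * (s (Suc n))\<^sup>2)" for n
          using K[of n] lam_pos[of "Suc n"] by (simp add: abs_mult mult_right_mono)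
      qed
      from summable_mult[OF this, of "4 / \<theta> * CARD('m)"]
      have "summable (\<lambda>n. 4 / \<theta> * (lam (Suc n))\<^sup>2 * ((s (Suc n))\<^sup>2 * (CARD('m) * lam (Suc n))))"
        by (simp add: mult_ac)
      moreover have "summable (\<lambda>n. 4 / \<theta> * (lam (Suc n))\<^sup>2 * (norm p)\<^sup>2)"
        using lam_sum by (intro summable_mult summable_mult2)
      moreover have "summable (\<lambda>n. \<theta> * (lam (Suc n) * bet (Suc n) * H (Suc n)))"
        by (intro summable_mult summable_Suc_iff[THEN iffD2, OF H_sum])
      ultimately have "summable (\<lambda>n. e (Suc n))"
        unfolding e_def by (intro summable_add)
      then show ?thesis by (rule summable_Suc_iff[THEN iffD1])
    qed

    define a where "a n = (\<integral>\<omega>. (norm (X n \<omega> - z))\<^sup>2 \<partial>M)" for n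
    define b where "b n = \<theta> / 2 * (\<integral>\<omega>. (norm (X (Suc n) \<omega> - X n \<omega>))\<^sup>2 \<partial>M)
        + \<delta> * (\<integral>\<omega>. lam n * bet n * (norm (grad\<Psi> (X n \<omega>)))\<^sup>2 \<partial>M)
        + \<theta> * (\<integral>\<omega>. lam n * bet n * \<Psi> (X n \<omega>) \<partial>M)" for n
    have a_nonneg: "0 \<le> a n" for n by (simp add: a_def)
    have b_nonneg: "0 \<le> b n" for n
      using th \<delta> lb_pos[of n] Psi_nonneg
      by (auto simp: b_def intro!: add_nonneg_nonneg mult_nonneg_nonneg integral_nonneg_AE)
    have step: "a (Suc n) + b n \<le> a n + e n" if n: "n \<ge> N" for n
    proof -
      define lhs where "lhs \<omega> = (norm (X (Suc n) \<omega> - z))\<^sup>2 + \<theta> / 2 * (norm (X (Suc n) \<omega> - X n \<omega>))\<^sup>2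
          + \<delta> * (lam n * bet n * (norm (grad\<Psi> (X n \<omega>)))\<^sup>2) + \<theta> * (lam n * bet n * \<Psi> (X n \<omega>))" for \<omega>
      define rhs where "rhs \<omega> = (norm (X n \<omega> - z))\<^sup>2 - 2 * lam n * inner (X n \<omega> - z) (w n \<omega>)
          + 4 / \<theta> * (lam n)\<^sup>2 * (norm (w n \<omega>))\<^sup>2 + 4 / \<theta> * (lam n)\<^sup>2 * (norm p)\<^sup>2
          + \<theta> * (lam n * bet n * H n)" for \<omega>
      have le: "lhs \<omega> \<le> rhs \<omega>" if \<omega>: "\<omega> \<in> space M" for \<omega>
        unfolding lhs_def rhs_def \<delta>_def
      proof (rule forward_backward_step[OF th L_pos lam_pos bet_pos])
        show "lam n * bet n \<le> c" using N0[of n] n by (simp add: N_def)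
        have "0 \<le> inner (X (Suc n) \<omega> - z) ((1 / lam n) *\<^sub>R (Y n \<omega> - X (Suc n) \<omega>) - (- p))"
          using mono resolvent_memberD[OF lam_pos X_res[OF \<omega>], of n] Az unfolding monotone_op_def by blast
        from mult_left_mono[OF this, of "lam n"]
        have "0 \<le> inner (X (Suc n) \<omega> - z) (lam n *\<^sub>R ((1 / lam n) *\<^sub>R (Y n \<omega> - X (Suc n) \<omega>) - (- p)))"
          using lam_pos[of n] by (simp only: inner_scaleR_right) simp
        also have "lam n *\<^sub>R ((1 / lam n) *\<^sub>R (Y n \<omega> - X (Suc n) \<omega>) - (- p))
            = X n \<omega> - X (Suc n) \<omega> - lam n *\<^sub>R (bet n *\<^sub>R grad\<Psi> (X n \<omega>) + w n \<omega>) + lam n *\<^sub>R p"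
          using lam_pos[of n] by (simp add: scaleR_add_right Y_def)
        finally show "0 \<le> inner (X (Suc n) \<omega> - z)
            (X n \<omega> - X (Suc n) \<omega> - lam n *\<^sub>R (bet n *\<^sub>R grad\<Psi> (X n \<omega>) + w n \<omega>) + lam n *\<^sub>R p)" .
        show "\<Psi> (X n \<omega>) + (norm (grad\<Psi> (X n \<omega>)))\<^sup>2 / (2 * L) \<le> inner (grad\<Psi> (X n \<omega>)) (X n \<omega> - z)"
          "(norm (grad\<Psi> (X n \<omega>)))\<^sup>2 / (2 * L) \<le> \<Psi> (X n \<omega>)"
          using gap_lower[OF zC] gap_upper[OF zC] by auto
        have "ereal (inner ((1 / bet n) *\<^sub>R (2 / \<theta>) *\<^sub>R p) (X n \<omega> - z) - \<Psi> (X n \<omega>)) \<le> ereal (H n)"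
          using fenchel_young_gap[OF cone, of n "X n \<omega>" \<Psi>] h_fin[of n] n by (simp add: h_def N_def)
        then show "inner ((1 / bet n) *\<^sub>R (2 / \<theta>) *\<^sub>R p) (X n \<omega> - z) - \<Psi> (X n \<omega>) \<le> H n" by simp
      qed
      have Xz: "(\<lambda>\<omega>. X n \<omega> - z) \<in> borel_measurable (F (t n))"
        by (intro borel_measurable_diff adapted borel_measurable_const)
      note cross = cross_int[OF Xz L2] cross_zero[OF Xz L2]
      have int_lhs: "integrable M lhs"
        unfolding lhs_def[abs_def] using L2[of "Suc n"] intD[of n] intG[of n] intP[of n] by simp
      have int_rhs: "integrable M rhs"
        unfolding rhs_def[abs_def] using L2[of n] noise_int[of n] cross(1) by simp
      have "a (Suc n) + b n = (\<integral>\<omega>. lhs \<omega> \<partial>M)"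
        unfolding lhs_def a_def b_def using L2[of "Suc n"] intD[of n] intG[of n] intP[of n] by simp
      also have "\<dots> \<le> (\<integral>\<omega>. rhs \<omega> \<partial>M)"
        by (rule integral_mono[OF int_lhs int_rhs le])
      also have "\<dots> = a n + 4 / \<theta> * (lam n)\<^sup>2 * (\<integral>\<omega>. (norm (w n \<omega>))\<^sup>2 \<partial>M)
          + 4 / \<theta> * (lam n)\<^sup>2 * (norm p)\<^sup>2 + \<theta> * (lam n * bet n * H n)"
        unfolding rhs_def a_def using L2[of n] noise_int[of n] cross by (simp add: prob_space)
      also have "\<dots> \<le> a n + e n"
        using mult_left_mono[OF noise_le[of n], of "4 / \<theta> * (lam n)\<^sup>2"] th by (simp add: e_def)
      finally show ?thesis .
    qed
    have "convergent a" "summable b"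
      using quasi_fejer_convergence[OF step a_nonneg b_nonneg e_nonneg e_sum] by blast+
    then show ?thesis
      using L2 intD intG intP unfolding a_def[abs_def] b_def[abs_def] by simp
  qed

  obtain z where z: "z \<in> op_zer (op_add A (normal_cone C))" using zer_nonempty by blast
  have zC: "z \<in> C" using z by (auto simp: op_zer_def op_add_def normal_cone_def split: if_splits)
  define D where "D n = (\<integral>\<omega>. (norm (X (Suc n) \<omega> - X n \<omega>))\<^sup>2 \<partial>M)" for n
  define G where "G n = (\<integral>\<omega>. lam n * bet n * (norm (grad\<Psi> (X n \<omega>)))\<^sup>2 \<partial>M)" for n
  define P where "P n = (\<integral>\<omega>. lam n * bet n * \<Psi> (X n \<omega>) \<partial>M)" for n
  have sum_b: "summable (\<lambda>n. \<theta> / 2 * D n + \<delta> * G n + \<theta> * P n)"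
    using main[OF z] unfolding D_def G_def P_def by blast
  have nonneg: "0 \<le> D n" "0 \<le> G n" "0 \<le> P n" for n
    using lam_pos[of n] bet_pos[of n] Psi_nonneg
    by (auto simp: D_def G_def P_def intro!: integral_nonneg_AE)
  have summand: "summable f" if "0 < k" "\<And>n. 0 \<le> f n" "\<And>n. k * f n \<le> \<theta> / 2 * D n + \<delta> * G n + \<theta> * P n"
    for f :: "nat \<Rightarrow> real" and k
  proof -
    have "summable (\<lambda>n. k * f n)"
      by (rule summable_comparison_test'[OF sum_b, of 0]) (use that in auto)
    then show ?thesis using that(1) by (simp add: summable_cmult_iff)
  qed
  have sums: "summable D" "summable G" "summable P"
    using th \<delta> nonneg
    by (auto intro!: summand[of "\<theta> / 2" D] summand[of \<delta> G] summand[of \<theta> P] add_nonneg_nonneg mult_nonneg_nonneg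
        simp: less_imp_le)

  \<comment> \<open>A lower bound on \<open>\<lambda>\<^sub>n \<beta>\<^sub>n\<close> turns the summability of \<open>E (\<lambda>\<^sub>n \<beta>\<^sub>n \<Psi>(X\<^sub>n))\<close> into that of \<open>E \<Psi>(X\<^sub>n)\<close>.\<close>
  have part3: "AE \<omega> in M. (\<lambda>n. \<Psi> (X n \<omega>)) \<longlonglongrightarrow> 0 \<and> (\<lambda>n. norm (grad\<Psi> (X n \<omega>))) \<longlonglongrightarrow> 0"
    if inf: "(INF n\<in>{1..}. lam n * bet n) > 0"
  proof -
    define \<iota> where "\<iota> = (INF n\<in>{1..}. lam n * bet n)"
    have i: "0 < \<iota>" using inf by (simp add: \<iota>_def)
    have i_le: "\<iota> \<le> lam (Suc n) * bet (Suc n)" for n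
      unfolding \<iota>_def
      by (rule cINF_lower) (auto intro!: bdd_belowI2[of _ 0] mult_nonneg_nonneg simp: lam_pos bet_pos less_imp_le)
    have intP: "integrable M (\<lambda>\<omega>. \<Psi> (X n \<omega>))" for n
    proof -
      have "integrable M (\<lambda>\<omega>. lam n * bet n * \<Psi> (X n \<omega>))" using main[OF z] by blast
      then show ?thesis using lam_pos[of n] bet_pos[of n] by simp
    qed
    have "summable (\<lambda>n. \<integral>\<omega>. \<Psi> (X (Suc n) \<omega>) \<partial>M)"
    proof (rule summable_comparison_test')
      show "summable (\<lambda>n. (1 / \<iota>) * P (Suc n))"
        by (intro summable_mult summable_Suc_iff[THEN iffD2, OF sums(3)])
      fix n
      have "\<iota> * (\<integral>\<omega>. \<Psi> (X (Suc n) \<omega>) \<partial>M) \<le> lam (Suc n) * bet (Suc n) * (\<integral>\<omega>. \<Psi> (X (Suc n) \<omega>) \<partial>M)"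
        using Psi_nonneg by (intro mult_right_mono i_le) (simp add: integral_nonneg_AE)
      also have "\<dots> = P (Suc n)" by (simp add: P_def)
      finally show "norm (\<integral>\<omega>. \<Psi> (X (Suc n) \<omega>) \<partial>M) \<le> (1 / \<iota>) * P (Suc n)"
        using i Psi_nonneg by (simp add: integral_nonneg_AE field_simps)
    qed
    then have "AE \<omega> in M. (\<lambda>n. \<Psi> (X (Suc n) \<omega>)) \<longlonglongrightarrow> 0"
      by (intro AE_tendsto_zero_of_summable_integral intP Psi_nonneg)
    then show ?thesis
    proof eventually_elim
      case (elim \<omega>)
      then have Psi0: "(\<lambda>n. \<Psi> (X n \<omega>)) \<longlonglongrightarrow> 0" by (rule LIMSEQ_imp_Suc)
      have grad_Psi: "(norm (grad\<Psi> x))\<^sup>2 \<le> 2 * L * \<Psi> x" for x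
        using gap_upper[OF zC, of x] L_pos by (simp add: pos_divide_le_eq mult_ac)
      have "(\<lambda>n. (norm (grad\<Psi> (X n \<omega>)))\<^sup>2) \<longlonglongrightarrow> 0"
      proof (rule tendsto_sandwich[OF _ _ tendsto_const])
        show "(\<lambda>n. 2 * L * \<Psi> (X n \<omega>)) \<longlonglongrightarrow> 0" using tendsto_mult_right_zero[OF Psi0] by simp
        show "eventually (\<lambda>n. (norm (grad\<Psi> (X n \<omega>)))\<^sup>2 \<le> 2 * L * \<Psi> (X n \<omega>)) sequentially"
          by (intro always_eventually allI grad_Psi)
      qed simp
      from tendsto_real_sqrt[OF this] Psi0 show ?case by simp
    qed
  qed

  show ?thesis
    using main z part3 sums[THEN summable_LIMSEQ_zero]
    unfolding D_def G_def P_def convergent_def by blast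
qed

end
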